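(* Let $q=3^d$ with $d\ge 1$, and let $\alpha\in\mathbb{F}_q$ be a fixed element with $\operatorname{Tr}(\alpha)=1$. Let $E\colon y^2=x^3+a_4x+a_6$ be an elliptic curve over $\mathbb{F}_q$ (so $a_4\neq 0$) of Type I, i.e. $-a_4=v^4$ for some $v\in\mathbb{F}_q^\times$. Then $E$ is isomorphic over $\mathbb{F}_q$ to $E_b\colon y^2=x^3-x+b$ with $b=a_6v^{-6}$, and every elliptic curve $y^2=x^3+a_4'x+a_6'$ over $\mathbb{F}_q$ that is isomorphic to $E$ over $\mathbb{F}_q$ is also of Type I. Moreover, for $b \in \mathbb{F}_q$, the curves $E_b\colon y^2=x^3-x+b$ are classified up to $\mathbb{F}_q$-isomorphism as follows. If $d$ is odd, there are exactly three isomorphism classes, and the class of $E_b$ depends only on (and is determined by) $\operatorname{Tr}(b)\in\mathbb{F}_3$: (i) if $\operatorname{Tr}(b)=0$, then $E_b$ is isomorphic to $E_0$; (ii) if $\operatorname{Tr}(b)=1$, then $E_b$ is isomorphic to $E_\alpha$; (iii) if $\operatorname{Tr}(b)=-1$, then $E_b$ is isomorphic to the quadratic twist of $E_\alpha$ by $-1$. If $d$ is even, there are exactly two isomorphism classes: (i) if $\operatorname{Tr}(b)=0$, then $E_b$ is isomorphic to $E_0$; (ii) if $\operatorname{Tr}(b)\neq 0$, then $E_b$ is isomorphic to $E_\alpha$.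
   Context: $\operatorname{Tr}$ denotes the trace map $\mathbb{F}_q\to\mathbb{F}_3$. In characteristic $3$, every supersingular elliptic curve over $\mathbb{F}_q$ can be written as $y^2=x^3+a_4x+a_6$ with $a_4\neq0$. For $D\in\mathbb{F}_q^\times$ a non-square, the quadratic twist of $y^2=x^3+ax+c$ by $D$ is $y^2=x^3+D^2ax+D^3c$; note that $-1$ is a non-square in $\mathbb{F}_q$ when $d$ is odd. *)

theory Defs
  imports "HOL-Algebra.Algebraic_Closure_Type" "HOL-Library.Cardinality"
begin

(* A curve y^2 = x^3 + a4 x + a6 with coefficients in K = 'a.  Its geometric points live in the
   projective plane over the algebraic closure; they are taken over the closure because for
   a finite K the K-rational points alone do not determine the curve. *)
datatype 'a wcurve = WCurve (coeff4: 'a) (coeff6: 'a)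

type_synonym 'k coords = "'k \<times> 'k \<times> 'k"

definition hpoint :: "'k::field coords \<Rightarrow> 'k coords set" where
  "hpoint v = (case v of (x, y, z) \<Rightarrow> {(c * x, c * y, c * z) | c. c \<noteq> 0})"

definition on_cubic :: "'a::field wcurve \<Rightarrow> 'a alg_closure coords \<Rightarrow> bool" where
  "on_cubic C v \<longleftrightarrow> (case v of (x, y, z) \<Rightarrow>
     y ^ 2 * z = x ^ 3 + to_ac (coeff4 C) * x * z ^ 2 + to_ac (coeff6 C) * z ^ 3)"

definition points :: "'a::field wcurve \<Rightarrow> 'a alg_closure coords set set" where
  "points C = {hpoint v | v. v \<noteq> (0, 0, 0) \<and> on_cubic C v}"

definition origin :: "'a::field alg_closure coords set" where
  "origin = hpoint (0, 1, 0)"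

(* The curve is smooth: the three partial derivatives of
   y^2 z - x^3 - a4 x z^2 - a6 z^3 have no common zero on it. *)
definition elliptic_curve :: "'a::field wcurve \<Rightarrow> bool" where
  "elliptic_curve C \<longleftrightarrow> (\<forall>x y z.
     (x, y, z) \<noteq> (0, 0, 0) \<longrightarrow> on_cubic C (x, y, z) \<longrightarrow>
       (- 3 * x ^ 2 - to_ac (coeff4 C) * z ^ 2,
        2 * y * z,
        y ^ 2 - 2 * to_ac (coeff4 C) * x * z - 3 * to_ac (coeff6 C) * z ^ 2) \<noteq> (0, 0, 0))"

(* Value of the ternary form of degree n over K whose coefficient at X^i Y^j Z^(n-i-j) is f i j. *)
definition form_eval ::
    "nat \<Rightarrow> (nat \<Rightarrow> nat \<Rightarrow> 'a::field) \<Rightarrow> 'a alg_closure coords \<Rightarrow> 'a alg_closure" where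
  "form_eval n f v = (case v of (x, y, z) \<Rightarrow>
     (\<Sum>i\<le>n. \<Sum>j\<le>n - i. to_ac (f i j) * x ^ i * y ^ j * z ^ (n - i - j)))"

definition forms_eval ::
    "nat \<Rightarrow> (nat \<Rightarrow> nat \<Rightarrow> 'a::field) coords \<Rightarrow> 'a alg_closure coords \<Rightarrow> 'a alg_closure coords" where
  "forms_eval n F v = (case F of (f, g, h) \<Rightarrow> (form_eval n f v, form_eval n g v, form_eval n h v))"

(* Morphisms over K: near every point, phi is given by three forms of the same degree with
   coefficients in K.  The curves are irreducible, so the forms then describe phi wherever they
   do not all vanish. *)
definition curve_morphism ::
    "'a::field wcurve \<Rightarrow> 'a wcurve \<Rightarrow>
     ('a alg_closure coords set \<Rightarrow> 'a alg_closure coords set) \<Rightarrow> bool" where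
  "curve_morphism C C' \<phi> \<longleftrightarrow>
     (\<forall>P\<in>points C. \<phi> P \<in> points C') \<and>
     (\<forall>P\<in>points C. \<exists>n F.
        (\<exists>v\<in>P. forms_eval n F v \<noteq> (0, 0, 0)) \<and>
        (\<forall>Q\<in>points C. \<forall>v\<in>Q. forms_eval n F v \<noteq> (0, 0, 0) \<longrightarrow> \<phi> Q = hpoint (forms_eval n F v)))"

(* Isomorphism over K of curves with the base point at infinity, i.e. of elliptic curves. *)
definition isomorphic_over :: "'a::field wcurve \<Rightarrow> 'a wcurve \<Rightarrow> bool" where
  "isomorphic_over C C' \<longleftrightarrow> (\<exists>\<phi> \<psi>.
     curve_morphism C C' \<phi> \<and> curve_morphism C' C \<psi> \<and>
     (\<forall>P\<in>points C. \<psi> (\<phi> P) = P) \<and> (\<forall>Q\<in>points C'. \<phi> (\<psi> Q) = Q) \<and>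
     \<phi> origin = origin)"

definition isomorphism_classes :: "'a::field wcurve set \<Rightarrow> 'a wcurve set set" where
  "isomorphism_classes S = S // {(C, C'). C \<in> S \<and> C' \<in> S \<and> isomorphic_over C C'}"

definition type_I :: "'a::field wcurve \<Rightarrow> bool" where
  "type_I C \<longleftrightarrow> (\<exists>v. v \<noteq> 0 \<and> - coeff4 C = v ^ 4)"

definition curve_E :: "'a::field \<Rightarrow> 'a wcurve" where
  "curve_E b = WCurve (- 1) b"

definition quadratic_twist :: "'a::field \<Rightarrow> 'a wcurve \<Rightarrow> 'a wcurve" where
  "quadratic_twist D C = WCurve (D ^ 2 * coeff4 C) (D ^ 3 * coeff6 C)"

(* The trace from the field with 3^d elements to F_3, the latter being the prime subfield
   {0, 1, -1} of 'a: the sum of the conjugates under the Frobenius map. *)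
definition Tr :: "nat \<Rightarrow> 'a::field \<Rightarrow> 'a" where
  "Tr d x = (\<Sum>i<d. x ^ (3 ^ i))"

end

theory Submission
  imports Defs
begin

text \<open>An isomorphism of the curves fixing the point at infinity restricts to the affine parts, and
  its coordinate functions, being regular there, have the form \<open>A(x) + B(x) y\<close> with polynomials
  over the base field. Pole orders at infinity are additive, and the coordinate functions \<open>X, Y\<close>
  satisfy the equation of the target, so their orders are \<open>2m\<close> and \<open>3m\<close>; every nonzero polynomial
  in \<open>X, Y\<close> then has order divisible by \<open>m\<close>. As \<open>x\<close> and \<open>y\<close>, of orders 2 and 3, are such
  polynomials by means of the inverse, \<open>m = 1\<close>, whence \<open>X = u\<^sup>2 x + r\<close> and \<open>Y = u\<^sup>3 y\<close>.

  So \<open>E\<^sub>b\<close> and \<open>E\<^sub>c\<close> are isomorphic iff \<open>c + r\<^sup>3 - r = u\<^sup>6 b\<close> for some \<open>r\<close> and \<open>u\<close> with \<open>u^4 = 1\<close>,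
  which by additive Hilbert 90 means \<open>Tr c = u\<^sup>2 Tr b\<close>; and \<open>u\<^sup>2\<close> can be \<open>-1\<close> iff \<open>d\<close> is even.\<close>

section \<open>Regular functions on the affine curve\<close>

definition affine :: "'a::field wcurve \<Rightarrow> ('a alg_closure \<times> 'a alg_closure) set" where
  "affine C = {(x, y). y ^ 2 = x ^ 3 + to_ac (coeff4 C) * x + to_ac (coeff6 C)}"

text \<open>Coefficients stay in the base field while arguments range over its closure, so
  identities of functions on \<open>affine C\<close> yield relations over the base field.\<close>

abbreviation ev :: "'a::field poly \<Rightarrow> 'a alg_closure \<Rightarrow> 'a alg_closure" where
  "ev p x \<equiv> poly (map_poly to_ac p) x"

lemma ev_pCons [simp]: "ev (pCons c p) x = to_ac c + x * ev p x"
  by (simp add: map_poly_pCons)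

lemma ev_add [simp]: "ev (p + q) x = ev p x + ev q x"
proof (induction p arbitrary: q)
  case (pCons a p)
  obtain b r where "q = pCons b r"
    by (cases q)
  then show ?case
    using pCons.IH[of r] by (simp add: distrib_left)
qed simp

lemma ev_smult [simp]: "ev (smult c p) x = to_ac c * ev p x"
  by (induction p) (simp_all add: algebra_simps)

lemma ev_minus [simp]: "ev (- p) x = - ev p x"
  by (induction p) (simp_all add: algebra_simps)

lemma ev_diff [simp]: "ev (p - q) x = ev p x - ev q x"
  using ev_add[of p "- q" x] by simp

lemma ev_mult [simp]: "ev (p * q) x = ev p x * ev q x"
  by (induction p) (simp_all add: algebra_simps)

lemma ev_1 [simp]: "ev 1 x = 1"
  by (simp add: one_pCons)

text \<open>For nonzero \<open>p\<close> the polynomial \<open>1 + X p\<close> is not constant, so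
  it has a root in the closure; but its value would be 1 everywhere.\<close>

lemma ev_eq_0_imp_eq_0:
  assumes "\<And>x. ev p x = 0"
  shows "p = 0"
proof (rule ccontr)
  assume p: "p \<noteq> 0"
  let ?q = "map_poly to_ac (pCons 1 p)"
  have "Polynomial.degree ?q > 0"
    using p by (subst Polynomial.degree_map_poly) auto
  then obtain x where "poly ?q x = 0"
    using alg_closed_imp_poly_has_root by blast
  then show False
    using assms by simp
qed

definition cubic :: "'a::field wcurve \<Rightarrow> 'a poly" where
  "cubic C = [:coeff6 C, coeff4 C, 0, 1:]"

lemma ev_cubic: "ev (cubic C) x = x ^ 3 + to_ac (coeff4 C) * x + to_ac (coeff6 C)"
  by (simp add: cubic_def algebra_simps power3_eq_cube)

lemma degree_cubic: "Polynomial.degree (cubic C) = 3"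
  by (simp add: cubic_def)

lemma cubic_nonzero: "cubic C \<noteq> 0"
  by (simp add: cubic_def)

lemma affine_iff: "(x, y) \<in> affine C \<longleftrightarrow> y ^ 2 = ev (cubic C) x"
  by (simp add: affine_def ev_cubic)

lemma affine_neg: "(x, y) \<in> affine C \<Longrightarrow> (x, - y) \<in> affine C"
  by (simp add: affine_iff)

lemma affine_point_over: "\<exists>y. (x, y) \<in> affine C"
  unfolding affine_iff by (rule nth_root_exists) simp

text \<open>The normal form \<open>A(x) + B(x) y\<close> of an element of the coordinate ring; only
  values on the affine curve count.\<close>

definition represents ::
    "'a::field wcurve \<Rightarrow> 'a poly \<Rightarrow> 'a poly \<Rightarrow> ('a alg_closure \<times> 'a alg_closure \<Rightarrow> 'a alg_closure) \<Rightarrow> bool"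
  where "represents C A B g \<longleftrightarrow> (\<forall>(x, y) \<in> affine C. g (x, y) = ev A x + ev B x * y)"

definition regular ::
    "'a::field wcurve \<Rightarrow> ('a alg_closure \<times> 'a alg_closure \<Rightarrow> 'a alg_closure) \<Rightarrow> bool"
  where "regular C g \<longleftrightarrow> (\<exists>A B. represents C A B g)"

lemma representsD: "represents C A B g \<Longrightarrow> (x, y) \<in> affine C \<Longrightarrow> g (x, y) = ev A x + ev B x * y"
  unfolding represents_def by fast

lemma represents_cong:
  "represents C A B g \<Longrightarrow> (\<And>q. q \<in> affine C \<Longrightarrow> g q = h q) \<Longrightarrow> represents C A B h"
  unfolding represents_def by fastforce

lemma represents_add:
  assumes "represents C A B g" "represents C A' B' h"
  shows "represents C (A + A') (B + B') (\<lambda>q. g q + h q)"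
  using representsD[OF assms(1)] representsD[OF assms(2)]
  unfolding represents_def by (auto simp: distrib_right)

lemma represents_mult:
  assumes "represents C A B g" "represents C A' B' h"
  shows "represents C (A * A' + cubic C * (B * B')) (A * B' + B * A') (\<lambda>q. g q * h q)"
proof -
  have "(ev A x + ev B x * y) * (ev A' x + ev B' x * y) =
      ev (A * A' + cubic C * (B * B')) x + ev (A * B' + B * A') x * y"
    if "(x, y) \<in> affine C" for x y
  proof -
    have "ev (cubic C) x = y * y"
      using that by (simp add: affine_iff power2_eq_square)
    then show ?thesis
      by (simp add: algebra_simps)
  qed
  then show ?thesis
    using representsD[OF assms(1)] representsD[OF assms(2)] unfolding represents_def by auto
qed

lemma represents_const: "represents C [:c:] 0 (\<lambda>_. to_ac c)"
  by (simp add: represents_def)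

lemma represents_fst: "represents C [:0, 1:] 0 fst"
  by (simp add: represents_def)

lemma represents_snd: "represents C 0 1 snd"
  by (simp add: represents_def)

lemma regular_cong:
  "regular C g \<Longrightarrow> (\<And>q. q \<in> affine C \<Longrightarrow> g q = h q) \<Longrightarrow> regular C h"
  unfolding regular_def using represents_cong by blast

lemma regular_add: "regular C g \<Longrightarrow> regular C h \<Longrightarrow> regular C (\<lambda>q. g q + h q)"
  unfolding regular_def using represents_add by blast

lemma regular_mult: "regular C g \<Longrightarrow> regular C h \<Longrightarrow> regular C (\<lambda>q. g q * h q)"
  unfolding regular_def using represents_mult by blast

lemma regular_const: "regular C (\<lambda>_. to_ac c)"
  unfolding regular_def using represents_const by blast

lemma regular_fst: "regular C fst"
  unfolding regular_def using represents_fst by blast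

lemma regular_snd: "regular C snd"
  unfolding regular_def using represents_snd by blast

lemma regular_ev: "regular C (\<lambda>q. ev p (fst q))"
  unfolding regular_def represents_def by (intro exI[of _ p] exI[of _ 0]) simp

lemma regular_power: "regular C g \<Longrightarrow> regular C (\<lambda>q. g q ^ n)"
proof (induction n)
  case 0
  then show ?case
    using regular_const[of C 1] by simp
next
  case (Suc n)
  then show ?case
    using regular_mult by fastforce
qed

lemma regular_sum: "(\<And>i. i \<in> I \<Longrightarrow> regular C (g i)) \<Longrightarrow> regular C (\<lambda>q. \<Sum>i\<in>I. g i q)"
proof (induction I rule: infinite_finite_induct)
  case (insert i I)
  then show ?case
    by (simp add: regular_add)
qed (use regular_const[of C 0] in simp_all)

text \<open>Adding the values at \<open>(x, y)\<close> and \<open>(x, - y)\<close> isolates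
  \<open>A\<close>, since 2 is invertible. This makes the normal form unique.\<close>

lemma represents_zero:
  fixes A B :: "'a::field poly"
  assumes "(2::'a) \<noteq> 0" and "represents C A B (\<lambda>_. 0)"
  shows "A = 0" and "B = 0"
proof -
  have two: "(2::'a alg_closure) \<noteq> 0"
    using assms(1) by (metis to_ac_eq_0_iff to_ac_numeral)
  \<comment> \<open>The factor \<open>cubic C\<close> covers those \<open>x\<close> with
    \<open>y = 0\<close>, where the two points over \<open>x\<close> coincide.\<close>
  have *: "ev (A * cubic C) x = 0 \<and> ev (B * cubic C) x = 0" for x
  proof -
    obtain y where y: "(x, y) \<in> affine C"
      using affine_point_over by blast
    show ?thesis
    proof (cases "y = 0")
      case True
      then show ?thesis
        using y by (simp add: affine_iff)
    next
      case False
      have e: "ev A x + ev B x * y = 0" "ev A x - ev B x * y = 0"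
        using assms(2) y affine_neg[OF y] unfolding represents_def by force+
      have "2 * ev A x = (ev A x + ev B x * y) + (ev A x - ev B x * y)"
        by simp
      then have "2 * ev A x = 0"
        using e by simp
      then have "ev A x = 0"
        using two by simp
      then show ?thesis
        using e(1) False by simp
    qed
  qed
  show "A = 0" "B = 0"
    using * ev_eq_0_imp_eq_0 cubic_nonzero no_zero_divisors by blast+
qed

lemma represents_unique:
  fixes A B A' B' :: "'a::field poly"
  assumes "(2::'a) \<noteq> 0" and "represents C A B g" and "represents C A' B' g"
  shows "A = A'" and "B = B'"
proof -
  have "represents C (A - A') (B - B') (\<lambda>_. 0)"
    using assms(2,3) unfolding represents_def by (auto simp: algebra_simps split: prod.splits)
  then show "A = A'" "B = B'"
    using represents_zero[OF assms(1)] by (metis eq_iff_diff_eq_0)+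
qed

text \<open>The denominators of a function on the affine curve form an ideal; the norm of a
  denominator that does not vanish at either point over \<open>x\<close> is a polynomial denominator
  that does not vanish at \<open>x\<close>.\<close>

lemma regular_if_locally_regular:
  fixes C :: "'a::field wcurve"
  assumes loc: "\<And>q. q \<in> affine C \<Longrightarrow>
    \<exists>h. regular C h \<and> regular C (\<lambda>q. h q * g q) \<and> h q \<noteq> 0"
  shows "regular C g"
proof -
  \<comment> \<open>The polynomial denominators of \<open>g\<close>, an ideal of the polynomial
    ring; the aim is \<open>1 \<in> J\<close>.\<close>
  define J where "J = {p. regular C (\<lambda>q. ev p (fst q) * g q)}"
  have J_add: "p + p' \<in> J" if "p \<in> J" "p' \<in> J" for p p'
    using regular_add[of C "\<lambda>q. ev p (fst q) * g q" "\<lambda>q. ev p' (fst q) * g q"] that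
    by (simp add: J_def algebra_simps)
  have J_mult: "r * p \<in> J" if "p \<in> J" for p r
    using regular_mult[OF regular_ev[of C r], of "\<lambda>q. ev p (fst q) * g q"] that
    by (simp add: J_def algebra_simps)
  have J_nonvanishing: "\<exists>p \<in> J. ev p x \<noteq> 0" for x
  proof -
    obtain y where y: "(x, y) \<in> affine C"
      using affine_point_over by blast
    obtain h1 where h1: "regular C h1" "regular C (\<lambda>q. h1 q * g q)" "h1 (x, y) \<noteq> 0"
      using loc[OF y] by blast
    obtain h2 where h2: "regular C h2" "regular C (\<lambda>q. h2 q * g q)" "h2 (x, - y) \<noteq> 0"
      using loc[OF affine_neg[OF y]] by blast
    have "regular C (\<lambda>q. h1 q + h2 q)" "regular C (\<lambda>q. (h1 q + h2 q) * g q)"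
      using h1 h2 by (simp_all add: regular_add distrib_right)
    \<comment> \<open>If each of \<open>h1\<close> and \<open>h2\<close> vanishes at the other's
      point, their sum vanishes at neither; otherwise \<open>h1\<close> or \<open>h2\<close> itself
      is nonzero at both points.\<close>
    moreover have "(h1 (x, - y) = 0 \<and> h2 (x, y) = 0) \<or> h1 (x, - y) \<noteq> 0 \<or> h2 (x, y) \<noteq> 0"
      by blast
    ultimately obtain h where h: "regular C h" "regular C (\<lambda>q. h q * g q)"
        "h (x, y) \<noteq> 0" "h (x, - y) \<noteq> 0"
      using h1 h2 by (metis add.left_neutral add.right_neutral)
    obtain A B where AB: "represents C A B h"
      using h(1) unfolding regular_def by blast
    define p where "p = A * A - cubic C * (B * B)"
    have p: "ev p u = (ev A u + ev B u * v) * (ev A u - ev B u * v)" if "(u, v) \<in> affine C" for u v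
    proof -
      have "ev (cubic C) u = v ^ 2"
        using that by (simp add: affine_iff)
      then show ?thesis
        by (simp add: p_def power2_eq_square algebra_simps)
    qed
    have "represents C A (- B) (\<lambda>q. ev A (fst q) - ev B (fst q) * snd q)"
      by (simp add: represents_def)
    then have "regular C (\<lambda>q. ev A (fst q) - ev B (fst q) * snd q)"
      unfolding regular_def by blast
    then have "regular C (\<lambda>q. (ev A (fst q) - ev B (fst q) * snd q) * (h q * g q))"
      using h(2) by (rule regular_mult)
    then have "regular C (\<lambda>q. ev p (fst q) * g q)"
      by (rule regular_cong) (use AB p in \<open>auto simp: represents_def\<close>)
    moreover have "ev p x = h (x, y) * h (x, - y)"
      using representsD[OF AB y] representsD[OF AB affine_neg[OF y]] p[OF y] by simp
    ultimately show ?thesis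
      using h by (auto simp: J_def)
  qed
  from this[of 0] obtain p0 where "p0 \<in> J" "ev p0 0 \<noteq> 0"
    by blast
  then have "p0 \<in> J \<and> p0 \<noteq> 0"
    by auto
  \<comment> \<open>An element of least degree generates \<open>J\<close>, by division with
    remainder.\<close>
  then obtain D where D: "D \<in> J" "D \<noteq> 0"
      and min: "\<And>p. p \<in> J \<Longrightarrow> p \<noteq> 0 \<Longrightarrow> Polynomial.degree D \<le> Polynomial.degree p"
    using ex_has_least_nat[of "\<lambda>p. p \<in> J \<and> p \<noteq> 0" p0 Polynomial.degree] by blast
  have dvd: "D dvd p" if "p \<in> J" for p
  proof -
    have "p + (- (p div D)) * D \<in> J"
      by (intro J_add J_mult that D(1))
    moreover have "p + (- (p div D)) * D = p mod D"
      by (simp add: minus_div_mult_eq_mod [symmetric])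
    ultimately have "p mod D = 0"
      using min[of "p mod D"] degree_mod_less[OF D(2), of p] by fastforce
    then show ?thesis
      by (simp add: dvd_eq_mod_eq_0)
  qed
  \<comment> \<open>A root of \<open>D\<close> in the closure would be a common zero of all of
    \<open>J\<close>.\<close>
  have "Polynomial.degree D = 0"
  proof (rule ccontr)
    assume "Polynomial.degree D \<noteq> 0"
    then have "Polynomial.degree (map_poly to_ac D) > 0"
      by (subst Polynomial.degree_map_poly) auto
    then obtain x where x: "ev D x = 0"
      using alg_closed_imp_poly_has_root by blast
    obtain p where "p \<in> J" "ev p x \<noteq> 0"
      using J_nonvanishing by blast
    then show False
      using dvd[of p] x by (auto elim!: dvdE)
  qed
  then obtain c where c: "D = [:c:]" "c \<noteq> 0"
    using D(2) by (auto elim: degree_eq_zeroE)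
  then have "[:inverse c:] * D = 1"
    by (simp add: one_pCons)
  then have "1 \<in> J"
    using J_mult[OF D(1)] by metis
  then show ?thesis
    by (simp add: J_def)
qed

section \<open>Pole orders at infinity\<close>

text \<open>The norm of \<open>A + B y\<close> down to the polynomials in \<open>x\<close>, that is,
  its product with the conjugate \<open>A - B y\<close>.\<close>

definition nm :: "'a::field wcurve \<Rightarrow> 'a poly \<Rightarrow> 'a poly \<Rightarrow> 'a poly" where
  "nm C A B = A ^ 2 - cubic C * B ^ 2"

text \<open>One term has even degree and the other odd degree, so their leading terms cannot
  cancel.\<close>

lemma degree_nm:
  assumes "A \<noteq> 0 \<or> B \<noteq> 0"
  shows "nm C A B \<noteq> 0" and "Polynomial.degree (nm C A B) =
    max (2 * Polynomial.degree A) (if B = 0 then 0 else 3 + 2 * Polynomial.degree B)"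
proof -
  have A: "Polynomial.degree (A ^ 2) = 2 * Polynomial.degree A"
    by (cases "A = 0") (simp_all add: degree_power_eq)
  have B: "Polynomial.degree (cubic C * B ^ 2) = 3 + 2 * Polynomial.degree B" if "B \<noteq> 0"
    using that by (simp add: degree_mult_eq cubic_nonzero degree_cubic degree_power_eq)
  have "nm C A B \<noteq> 0 \<and> Polynomial.degree (nm C A B) =
    max (2 * Polynomial.degree A) (if B = 0 then 0 else 3 + 2 * Polynomial.degree B)"
  proof (cases "B = 0")
    case True
    then show ?thesis
      using A assms by (simp add: nm_def)
  next
    case False
    have "2 * Polynomial.degree A \<noteq> 3 + 2 * Polynomial.degree B"
      by presburger
    then consider "Polynomial.degree (A ^ 2) < Polynomial.degree (cubic C * B ^ 2)"
      | "Polynomial.degree (cubic C * B ^ 2) < Polynomial.degree (A ^ 2)"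
      using A B[OF False] by linarith
    then show ?thesis
    proof cases
      case 1
      have "Polynomial.degree (nm C A B) = Polynomial.degree (cubic C * B ^ 2)"
        unfolding nm_def using degree_add_eq_right[of "A ^ 2" "- (cubic C * B ^ 2)"] 1 by simp
      then show ?thesis
        using 1 A B[OF False] False by (auto simp: max_def)
    next
      case 2
      have "Polynomial.degree (nm C A B) = Polynomial.degree (A ^ 2)"
        unfolding nm_def using degree_add_eq_left[of "- (cubic C * B ^ 2)" "A ^ 2"] 2 by simp
      then show ?thesis
        using 2 A B[OF False] False by (auto simp: max_def)
    qed
  qed
  then show "nm C A B \<noteq> 0" "Polynomial.degree (nm C A B) =
    max (2 * Polynomial.degree A) (if B = 0 then 0 else 3 + 2 * Polynomial.degree B)"
    by blast+
qed

text \<open>The order of the pole at infinity, read off as the degree of the norm.\<close>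

definition has_order ::
    "'a::field wcurve \<Rightarrow> ('a alg_closure \<times> 'a alg_closure \<Rightarrow> 'a alg_closure) \<Rightarrow> nat \<Rightarrow> bool"
  where "has_order C g n \<longleftrightarrow> (\<exists>A B. represents C A B g \<and> (A \<noteq> 0 \<or> B \<noteq> 0) \<and>
    n = Polynomial.degree (nm C A B))"

lemma has_order_cong:
  "has_order C g n \<Longrightarrow> (\<And>q. q \<in> affine C \<Longrightarrow> g q = h q) \<Longrightarrow> has_order C h n"
  unfolding has_order_def using represents_cong by blast

lemma has_order_unique:
  fixes C :: "'a::field wcurve"
  assumes "(2::'a) \<noteq> 0" "has_order C g n" "has_order C g m"
  shows "n = m"
  using assms represents_unique unfolding has_order_def by blast

lemma regular_cases:
  assumes "regular C g"
  obtains n where "has_order C g n" | "\<And>q. q \<in> affine C \<Longrightarrow> g q = 0"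
proof -
  obtain A B where AB: "represents C A B g"
    using assms unfolding regular_def by blast
  show thesis
  proof (cases "A = 0 \<and> B = 0")
    case True
    then show thesis
      using AB that(2) unfolding represents_def by fastforce
  next
    case False
    then show thesis
      using AB that(1) unfolding has_order_def by blast
  qed
qed

lemma has_order_const: "c \<noteq> 0 \<Longrightarrow> has_order C (\<lambda>_. to_ac c) 0"
  unfolding has_order_def using represents_const[of C c]
  by (intro exI[of _ "[:c:]"] exI[of _ 0]) (simp add: nm_def power2_eq_square)

lemma has_order_fst: "has_order C fst 2"
  unfolding has_order_def using represents_fst[of C]
  by (intro exI[of _ "[:0, 1:]"] exI[of _ 0]) (simp add: nm_def power2_eq_square)

lemma has_order_snd: "has_order C snd 3"
  unfolding has_order_def using represents_snd[of C]
  by (intro exI[of _ 0] exI[of _ 1]) (simp add: nm_def degree_cubic)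

text \<open>Follows from uniqueness of the normal form. With \<open>s = 0\<close> it serves to show
  that a function of positive order is not identically zero.\<close>

lemma has_order_of_const:
  fixes C :: "'a::field wcurve"
  assumes "(2::'a) \<noteq> 0" "has_order C g n" "\<And>q. q \<in> affine C \<Longrightarrow> g q = to_ac s"
  shows "n = 0"
proof -
  obtain A B where AB: "represents C A B g" "n = Polynomial.degree (nm C A B)"
    using assms(2) unfolding has_order_def by blast
  have "represents C [:s:] 0 g"
    using represents_cong[OF represents_const[of C s], of g] assms(3) by simp
  then have "A = [:s:]" "B = 0"
    using represents_unique[OF assms(1) AB(1)] by blast+
  then show ?thesis
    using AB(2) by (simp add: nm_def power2_eq_square)
qed

text \<open>A nonzero \<open>B\<close> would give the norm degree at least 3, so only a constant
  \<open>A\<close> remains.\<close>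

lemma has_order_0_imp_const:
  assumes "has_order C g 0"
  obtains s where "\<And>q. q \<in> affine C \<Longrightarrow> g q = to_ac s"
proof -
  obtain A B where AB: "represents C A B g" "A \<noteq> 0 \<or> B \<noteq> 0" "Polynomial.degree (nm C A B) = 0"
    using assms unfolding has_order_def by metis
  have "B = 0" "Polynomial.degree A = 0"
    using degree_nm(2)[OF AB(2), of C] AB(3) by (auto split: if_splits)
  then obtain s where "A = [:s:]"
    by (auto elim: degree_eq_zeroE)
  then show thesis
    using AB(1) \<open>B = 0\<close> that[of s] by (auto simp: represents_def)
qed

text \<open>The norm is multiplicative, and degrees of nonzero polynomials add.\<close>

lemma has_order_mult:
  assumes "has_order C g n" "has_order C h m"
  shows "has_order C (\<lambda>q. g q * h q) (n + m)"
proof -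
  obtain A B where AB: "represents C A B g" "A \<noteq> 0 \<or> B \<noteq> 0" "n = Polynomial.degree (nm C A B)"
    using assms(1) unfolding has_order_def by metis
  obtain A' B' where AB': "represents C A' B' h" "A' \<noteq> 0 \<or> B' \<noteq> 0" "m = Polynomial.degree (nm C A' B')"
    using assms(2) unfolding has_order_def by metis
  let ?A = "A * A' + cubic C * (B * B')" and ?B = "A * B' + B * A'"
  have nm: "nm C ?A ?B = nm C A B * nm C A' B'"
    by (simp add: nm_def power2_eq_square algebra_simps)
  have "nm C A B \<noteq> 0" "nm C A' B' \<noteq> 0"
    using degree_nm(1) AB(2) AB'(2) by blast+
  then have "nm C ?A ?B \<noteq> 0" and deg: "Polynomial.degree (nm C ?A ?B) = n + m"
    unfolding nm AB(3) AB'(3) by (simp_all add: degree_mult_eq)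
  then have "?A \<noteq> 0 \<or> ?B \<noteq> 0"
    by (auto simp: nm_def)
  then show ?thesis
    unfolding has_order_def using represents_mult[OF AB(1) AB'(1)] deg by metis
qed

text \<open>The leading term of the summand with the larger pole order survives in the sum.\<close>

lemma has_order_add_less:
  assumes "has_order C g n" "has_order C h m" "m < n"
  shows "has_order C (\<lambda>q. g q + h q) n"
proof -
  obtain A B where AB: "represents C A B g" "A \<noteq> 0 \<or> B \<noteq> 0" "n = Polynomial.degree (nm C A B)"
    using assms(1) unfolding has_order_def by metis
  obtain A' B' where AB': "represents C A' B' h" "A' \<noteq> 0 \<or> B' \<noteq> 0" "m = Polynomial.degree (nm C A' B')"
    using assms(2) unfolding has_order_def by metis
  note n = AB(3)[unfolded degree_nm(2)[OF AB(2)]]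
  note m = AB'(3)[unfolded degree_nm(2)[OF AB'(2)]]
  have le: "Polynomial.degree (A + A') \<le> max (Polynomial.degree A) (Polynomial.degree A')"
    "Polynomial.degree (B + B') \<le> max (Polynomial.degree B) (Polynomial.degree B')"
    by (rule degree_add_le_max)+
  have "(A + A' \<noteq> 0 \<or> B + B' \<noteq> 0) \<and>
    n = max (2 * Polynomial.degree (A + A')) (if B + B' = 0 then 0 else 3 + 2 * Polynomial.degree (B + B'))"
  \<comment> \<open>The order is odd when \<open>B\<close> produces the pole and even when
    \<open>A\<close> does; in that component the other summand is zero or has smaller
    degree.\<close>
  proof (cases "B \<noteq> 0 \<and> n = 3 + 2 * Polynomial.degree B")
    case True
    then have "B' = 0 \<or> Polynomial.degree B' < Polynomial.degree B"
      using m assms(3) by (auto split: if_splits)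
    then have "Polynomial.degree (B + B') = Polynomial.degree B" "B + B' \<noteq> 0"
      using True degree_add_eq_left[of B' B] by (auto simp: add_eq_0_iff)
    then show ?thesis
      using True n m assms(3) le by (auto split: if_splits simp: max_def)
  next
    case False
    then have nA: "n = 2 * Polynomial.degree A"
      using n by (auto split: if_splits simp: max_def)
    then have lt: "Polynomial.degree A' < Polynomial.degree A"
      using m assms(3) by (auto split: if_splits)
    then have "Polynomial.degree (A + A') = Polynomial.degree A" "A + A' \<noteq> 0"
      using degree_add_eq_left[of A' A] by (auto simp: add_eq_0_iff)
    then show ?thesis
      using nA n m assms(3) le by (auto split: if_splits simp: max_def)
  qed
  then show ?thesis
    unfolding has_order_def using represents_add[OF AB(1) AB'(1)] degree_nm(2) by metis
qed

text \<open>Horner's scheme: each multiplication by \<open>g\<close> adds \<open>n\<close> to the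
  order, and the constants added have order 0, which is less than \<open>n\<close>.\<close>

lemma has_order_ev:
  assumes "has_order C g n" "n > 0" "p \<noteq> 0"
  shows "has_order C (\<lambda>q. ev p (g q)) (n * Polynomial.degree p)"
  using assms(3)
proof (induction p)
  case (pCons c p)
  show ?case
  proof (cases "p = 0")
    case True
    then show ?thesis
      using pCons has_order_const[of c C] by simp
  next
    case False
    have *: "has_order C (\<lambda>q. g q * ev p (g q)) (n + n * Polynomial.degree p)"
      using has_order_mult[OF assms(1)] pCons.IH False by blast
    show ?thesis
    proof (cases "c = 0")
      case True
      then show ?thesis
        using * False by simp
    next
      case c: False
      show ?thesis
        using has_order_add_less[OF * has_order_const[OF c]] assms(2) False
        by (simp add: add.commute)
    qed
  qed
qed simp

text \<open>If both summands are nonzero, their orders are \<open>m\<close> times an even and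
  \<open>m\<close> times an odd number; being distinct, the larger one is the order of the
  sum.\<close>

lemma has_order_combination:
  fixes C :: "'a::field wcurve"
  assumes "has_order C g (2 * m)" "has_order C h (3 * m)" "m > 0" "P \<noteq> 0 \<or> Q \<noteq> 0"
  shows "\<exists>j. has_order C (\<lambda>q. ev P (g q) + ev Q (g q) * h q) (m * j)"
proof -
  let ?j = "2 * Polynomial.degree P" and ?k = "2 * Polynomial.degree Q + 3"
  have P: "has_order C (\<lambda>q. ev P (g q)) (m * ?j)" if "P \<noteq> 0"
    using has_order_ev[OF assms(1) _ that] assms(3) by (simp add: mult_ac)
  have Q: "has_order C (\<lambda>q. ev Q (g q) * h q) (m * ?k)" if "Q \<noteq> 0"
    using has_order_mult[OF has_order_ev[OF assms(1) _ that] assms(2)] assms(3)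
    by (simp add: algebra_simps)
  show ?thesis
  proof (cases "P = 0 \<or> Q = 0")
    case True
    then show ?thesis
      using P Q assms(4) by auto
  next
    case False
    have "?j \<noteq> ?k"
      by presburger
    then consider "m * ?j < m * ?k" | "m * ?k < m * ?j"
      using assms(3) by (metis linorder_neqE_nat mult_less_mono2)
    then show ?thesis
    proof cases
      case 1
      then show ?thesis
        using has_order_add_less[OF Q P 1] False by (auto simp: add.commute)
    next
      case 2
      then show ?thesis
        using has_order_add_less[OF P Q 2] False by auto
    qed
  qed
qed

text \<open>The equation of \<open>C'\<close> makes twice the order of \<open>h\<close> equal to
  three times that of \<open>g\<close>, so the orders are \<open>3 m\<close> and \<open>2 m\<close>.
  The inverse writes \<open>x\<close> and \<open>y\<close> as polynomials in \<open>g\<close> and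
  \<open>h\<close>, so \<open>m\<close> divides both 2 and 3.\<close>

lemma regular_iso_degree:
  fixes C C' :: "'a::field wcurve"
  assumes two: "(2::'a) \<noteq> 0"
    and reg: "regular C g" "regular C h" "regular C' g'" "regular C' h'"
    and maps: "\<And>q. q \<in> affine C \<Longrightarrow> (g q, h q) \<in> affine C'"
    and inv: "\<And>q. q \<in> affine C \<Longrightarrow> (g' (g q, h q), h' (g q, h q)) = q"
  shows "has_order C g 2" and "has_order C h 3"
proof -
  \<comment> \<open>Two distinct points of \<open>C\<close>, which show that a map with a left
    inverse is not constant.\<close>
  obtain y0 y1 where y: "(0, y0) \<in> affine C" "(1, y1) \<in> affine C"
    using affine_point_over by metis
  have eq: "h q * h q = ev (cubic C') (g q)" if "q \<in> affine C" for q
    using maps[OF that] by (simp add: affine_iff power2_eq_square)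
  \<comment> \<open>If \<open>h\<close> vanished identically, so would the cubic in
    \<open>g\<close>, which has positive order.\<close>
  have ord_h: "\<exists>n. has_order C h n" if "has_order C (\<lambda>q. ev (cubic C') (g q)) k" "k > 0" for k
    using reg(2)
  proof (cases rule: regular_cases)
    case 2
    then have "k = 0"
      using eq by (intro has_order_of_const[OF two that(1), of 0]) (simp flip: eq)
    then show ?thesis
      using that by simp
  qed blast
  \<comment> \<open>A constant \<open>g\<close> makes \<open>h * h\<close> constant, hence
    \<open>h\<close> too, and all points of \<open>C\<close> would have the same image.\<close>
  have const: False if s: "\<And>q. q \<in> affine C \<Longrightarrow> g q = to_ac s" for s
  proof -
    have "\<exists>t. \<forall>q \<in> affine C. h q = to_ac t"
      using reg(2)
    proof (cases rule: regular_cases)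
      case (1 n)
      have "n + n = 0"
        using eq s
        by (intro has_order_of_const[OF two has_order_mult[OF 1 1], of "poly (cubic C') s"])
          (simp add: ev_cubic cubic_def power3_eq_cube algebra_simps)
      then show ?thesis
        using has_order_0_imp_const 1 by (metis add_is_0)
    next
      case 2
      then show ?thesis
        by (metis to_ac_0)
    qed
    then obtain t where "\<And>q. q \<in> affine C \<Longrightarrow> h q = to_ac t"
      by blast
    then have "(0 :: 'a alg_closure, y0) = (1, y1)"
      using inv[OF y(1)] inv[OF y(2)] s y by simp
    then show False
      by simp
  qed
  obtain M where M: "has_order C g M"
    using reg(1) by (cases rule: regular_cases) (use const[of 0] in auto)
  have "M > 0"
    using has_order_0_imp_const[of C g] M const by (metis gr0I)
  then have cub: "has_order C (\<lambda>q. ev (cubic C') (g q)) (M * 3)"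
    using has_order_ev[OF M _ cubic_nonzero] degree_cubic by metis
  then obtain n where n: "has_order C h n"
    using ord_h \<open>M > 0\<close> by (metis nat_0_less_mult_iff zero_less_numeral)
  have "n + n = M * 3"
    using has_order_unique[OF two has_order_cong[OF has_order_mult[OF n n]] cub] eq by blast
  moreover define m where "m = M div 2"
  ultimately have Mm: "M = 2 * m" and nm: "n = 3 * m"
    by presburger+
  have "m > 0"
    using Mm \<open>M > 0\<close> by simp
  \<comment> \<open>Here \<open>f\<close> will be a coordinate function of \<open>C\<close>, and
    \<open>f'\<close> the component of the inverse that recovers it.\<close>
  have ord_dvd: "m dvd k" if "regular C' f'" "has_order C f k" "k > 0"
    "\<And>q. q \<in> affine C \<Longrightarrow> f' (g q, h q) = f q" for f' f k
  proof -
    obtain P Q where PQ: "represents C' P Q f'"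
      using \<open>regular C' f'\<close> unfolding regular_def by blast
    have f: "ev P (g q) + ev Q (g q) * h q = f q" if "q \<in> affine C" for q
      using representsD[OF PQ maps[OF that]] \<open>\<And>q. q \<in> affine C \<Longrightarrow> f' (g q, h q) = f q\<close> that
      by simp
    have "P \<noteq> 0 \<or> Q \<noteq> 0"
    proof (rule ccontr)
      assume "\<not> (P \<noteq> 0 \<or> Q \<noteq> 0)"
      then have "k = 0"
        using f by (intro has_order_of_const[OF two that(2), of 0]) (simp flip: f)
      then show False
        using that(3) by simp
    qed
    then obtain j where "has_order C (\<lambda>q. ev P (g q) + ev Q (g q) * h q) (m * j)"
      using has_order_combination[of C g m h P Q] M n Mm nm \<open>m > 0\<close> by blast
    then have "m * j = k"
      using has_order_unique[OF two has_order_cong that(2)] f by blast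
    then show ?thesis
      by auto
  qed
  have "m dvd 2" "m dvd 3"
    using ord_dvd[OF reg(3) has_order_fst] ord_dvd[OF reg(4) has_order_snd] inv
    by (metis fst_conv zero_less_numeral, metis snd_conv zero_less_numeral)
  then have "m dvd 3 - 2"
    by (rule dvd_diff_nat[rotated])
  then have "m = 1"
    by simp
  then show "has_order C g 2" "has_order C h 3"
    using M n Mm nm by simp_all
qed

text \<open>Pole orders 2 and 3 force \<open>g = a x + r\<close> and \<open>h = G(x) + e y\<close>; comparing coefficients
  in the equation of \<open>C'\<close> then gives \<open>G = 0\<close> and the relations between the coefficients.\<close>

lemma regular_iso_linear:
  fixes C C' :: "'a::field wcurve"
  assumes two: "(2::'a) \<noteq> 0"
    and "has_order C g 2" "has_order C h 3"
    and maps: "\<And>q. q \<in> affine C \<Longrightarrow> (g q, h q) \<in> affine C'"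
  obtains a e r where "a \<noteq> 0" "e \<noteq> 0" "e ^ 2 = a ^ 3"
    "e ^ 2 * coeff4 C = 3 * a * r ^ 2 + coeff4 C' * a"
    "e ^ 2 * coeff6 C = r ^ 3 + coeff4 C' * r + coeff6 C'"
proof -
  obtain A B where AB: "represents C A B g" "A \<noteq> 0 \<or> B \<noteq> 0" "2 = Polynomial.degree (nm C A B)"
    using assms(2) unfolding has_order_def by metis
  obtain G E where GE: "represents C G E h" "G \<noteq> 0 \<or> E \<noteq> 0" "3 = Polynomial.degree (nm C G E)"
    using assms(3) unfolding has_order_def by metis
  note deg_AB = AB(3)[unfolded degree_nm(2)[OF AB(2)]]
  note deg_GE = GE(3)[unfolded degree_nm(2)[OF GE(2)]]
  \<comment> \<open>A nonzero \<open>B\<close> would force order at least 3.\<close>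
  have "B = 0" "Polynomial.degree A = 1"
    using deg_AB by (auto split: if_splits simp: max_def)
  then obtain r a where A: "A = [:r, a:]" "a \<noteq> 0"
    using degree1_coeffs by metis
  \<comment> \<open>By parity the order 3 of \<open>h\<close> comes from its \<open>y\<close>-part,
    whose coefficient \<open>E\<close> must then be constant.\<close>
  have "2 * Polynomial.degree G \<noteq> 3"
    by presburger
  then have E: "E \<noteq> 0" "Polynomial.degree E = 0"
    using deg_GE by (auto split: if_splits simp: max_def)
  then obtain e where e: "E = [:e:]" "e \<noteq> 0"
    by (auto elim: degree_eq_zeroE)
  \<comment> \<open>The cubic of \<open>C'\<close> at \<open>r + a x\<close>, expanded in powers of
    \<open>x\<close>.\<close>
  let ?R = "[:r ^ 3 + coeff4 C' * r + coeff6 C', 3 * a * r ^ 2 + coeff4 C' * a, 3 * a ^ 2 * r, a ^ 3:]"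
  \<comment> \<open>This is the normal form of \<open>h^2\<close> minus the cubic of
    \<open>C'\<close> at \<open>g\<close>, a function that is zero on \<open>C\<close>; its
    \<open>y\<close>-coefficient \<open>2 e G\<close> forces \<open>G = 0\<close>.\<close>
  have "represents C (G * G + smult (e * e) (cubic C) - ?R) (smult (2 * e) G) (\<lambda>_. 0)"
    unfolding represents_def
  proof clarify
    fix x y assume q: "(x, y) \<in> affine C"
    have "h (x, y) ^ 2 = ev (cubic C') (g (x, y))"
      using maps[OF q] by (simp add: affine_iff)
    then have "(ev G x + to_ac e * y) * (ev G x + to_ac e * y) =
        ev (cubic C') (to_ac r + x * to_ac a)"
      using representsD[OF AB(1) q] representsD[OF GE(1) q] A e \<open>B = 0\<close>
      by (simp add: power2_eq_square)
    also have "\<dots> = ev ?R x"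
      by (simp add: ev_cubic power2_eq_square power3_eq_cube algebra_simps)
    finally have "ev ?R x = ev G x * ev G x + to_ac (2 * e) * ev G x * y + to_ac (e * e) * (y * y)"
      by (simp add: algebra_simps)
    moreover have "y * y = ev (cubic C) x"
      using q by (simp add: affine_iff power2_eq_square)
    ultimately show "0 = ev (G * G + smult (e * e) (cubic C) - ?R) x + ev (smult (2 * e) G) x * y"
      by (simp only: ev_add ev_diff ev_mult ev_smult) simp
  qed
  note rel = represents_zero[OF two this]
  then have G: "G = 0"
    using e two by simp
  have "smult (e * e) (cubic C) = ?R"
    using rel(1) G by simp
  then have "e * e = a ^ 3" "e * e * coeff4 C = 3 * a * r ^ 2 + coeff4 C' * a"
    "e * e * coeff6 C = r ^ 3 + coeff4 C' * r + coeff6 C'"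
    unfolding cubic_def smult_pCons pCons_eq_iff mult_1_right by blast+
  then show thesis
    by (intro that[of a e r] A(2) e(2)) (simp_all add: power2_eq_square)
qed

section \<open>Isomorphisms as Weierstrass substitutions\<close>

lemma self_in_hpoint: "v \<in> hpoint v"
  unfolding hpoint_def by (cases v) (auto intro: exI[of _ 1])

lemma hpoint_image: "hpoint (x, y, z) = (\<lambda>c. (c * x, c * y, c * z)) ` {c. c \<noteq> 0}"
  by (auto simp: hpoint_def)

lemma hpoint_scale: "c \<noteq> 0 \<Longrightarrow> hpoint (c * x, c * y, c * z) = hpoint (x, y, z)"
  unfolding hpoint_def
  by (auto intro: exI[of _ "_ * c"] exI[of _ "_ / c"] simp: mult.assoc)

lemma mem_hpoint_imp_eq:
  assumes "w \<in> hpoint v"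
  shows "hpoint w = hpoint v"
proof (cases v)
  case (fields x y z)
  then obtain c where "c \<noteq> 0" "w = (c * x, c * y, c * z)"
    using assms unfolding hpoint_def by auto
  then show ?thesis
    using hpoint_scale fields by simp
qed

definition affine_point :: "'a::field alg_closure \<times> 'a alg_closure \<Rightarrow> 'a alg_closure coords set" where
  "affine_point q = hpoint (fst q, snd q, 1)"

lemma hpoint_eq_affine_point:
  assumes "hpoint (x, y, z) = affine_point q"
  shows "z \<noteq> 0" "x = z * fst q" "y = z * snd q"
  using self_in_hpoint[of "(x, y, z)"] unfolding assms affine_point_def
  by (auto simp: hpoint_def)

lemma affine_point_inj: "affine_point q = affine_point q' \<Longrightarrow> q = q'"
  using hpoint_eq_affine_point[of "fst q" "snd q" 1 q'] by (simp add: affine_point_def prod_eq_iff)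

lemma origin_in_points: "origin \<in> points C"
  unfolding origin_def points_def on_cubic_def by force

lemma affine_point_neq_origin: "affine_point q \<noteq> origin"
  using hpoint_eq_affine_point(1)[of 0 1 0 q] by (auto simp: origin_def)

lemma affine_point_in_points: "q \<in> affine C \<Longrightarrow> affine_point q \<in> points C"
  unfolding affine_point_def points_def on_cubic_def affine_def by (cases q) force

text \<open>At \<open>z = 0\<close> the equation reads \<open>x^3 = 0\<close>, which leaves only the
  origin; elsewhere one divides by \<open>z\<close>.\<close>

lemma points_cases:
  assumes "P \<in> points C" "P \<noteq> origin"
  obtains q where "q \<in> affine C" "P = affine_point q"
proof -
  obtain x y z where v: "P = hpoint (x, y, z)" "(x, y, z) \<noteq> (0, 0, 0)" and
    cub: "y ^ 2 * z = x ^ 3 + to_ac (coeff4 C) * x * z ^ 2 + to_ac (coeff6 C) * z ^ 3"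
    using assms(1) unfolding points_def on_cubic_def by auto
  have "z \<noteq> 0"
  proof
    assume "z = 0"
    then have "x = 0" "y \<noteq> 0"
      using cub v(2) by simp_all
    then have "P = origin"
      using v(1) \<open>z = 0\<close> hpoint_scale[of y 0 1 0] by (simp add: origin_def)
    then show False
      using assms(2) by simp
  qed
  show thesis
  proof
    show "(x / z, y / z) \<in> affine C"
      using cub \<open>z \<noteq> 0\<close> unfolding affine_def
      by (simp add: field_simps power2_eq_square power3_eq_cube)
    show "P = affine_point (x / z, y / z)"
      using v(1) hpoint_scale[OF \<open>z \<noteq> 0\<close>, of "x / z" "y / z" 1] \<open>z \<noteq> 0\<close>
      by (simp add: affine_point_def)
  qed
qed

section \<open>Coordinate functions of morphisms\<close>

lemma form_eval_scale:
  "form_eval n f (c * x, c * y, c * z) = c ^ n * form_eval n f (x, y, z)"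
proof -
  have "to_ac (f i j) * (c * x) ^ i * (c * y) ^ j * (c * z) ^ (n - i - j) =
      c ^ n * (to_ac (f i j) * x ^ i * y ^ j * z ^ (n - i - j))"
    if "i \<le> n" "j \<le> n - i" for i j
  proof -
    have "n = i + j + (n - i - j)"
      using that by simp
    then have "c ^ n = c ^ i * c ^ j * c ^ (n - i - j)"
      by (metis power_add)
    then show ?thesis
      by (simp add: power_mult_distrib mult_ac)
  qed
  then show ?thesis
    unfolding form_eval_def prod.case sum_distrib_left by (intro sum.cong refl) simp_all
qed

lemma regular_form_eval: "regular C (\<lambda>q. form_eval n f (fst q, snd q, 1))"
  unfolding form_eval_def
  by (simp, intro regular_sum regular_mult regular_const regular_power regular_fst regular_snd)

text \<open>Near a point the coordinates of \<open>\<Phi>\<close> are quotients of the first two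
  forms by the third. The third is nonzero there because the image is affine, so it is a local
  denominator for both coordinates.\<close>

lemma morphism_regular:
  assumes mor: "curve_morphism C C' \<phi>"
    and \<Phi>: "\<And>q. q \<in> affine C \<Longrightarrow> \<phi> (affine_point q) = affine_point (\<Phi> q)"
  shows "regular C (\<lambda>q. fst (\<Phi> q))" and "regular C (\<lambda>q. snd (\<Phi> q))"
proof -
  have *: "\<exists>h k l. regular C h \<and> regular C k \<and> regular C l \<and> h p \<noteq> 0 \<and>
      (\<forall>q \<in> affine C. h q * fst (\<Phi> q) = k q \<and> h q * snd (\<Phi> q) = l q)"
    if p: "p \<in> affine C" for p
  proof -
    have "\<exists>n F. (\<exists>v\<in>affine_point p. forms_eval n F v \<noteq> (0, 0, 0)) \<and>
        (\<forall>Q\<in>points C. \<forall>v\<in>Q. forms_eval n F v \<noteq> (0, 0, 0) \<longrightarrow> \<phi> Q = hpoint (forms_eval n F v))"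
      using mor affine_point_in_points[OF p] unfolding curve_morphism_def by (elim conjE) (rule bspec)
    then obtain n F where ex: "\<exists>v\<in>affine_point p. forms_eval n F v \<noteq> (0, 0, 0)"
      and F: "\<forall>Q\<in>points C. \<forall>v\<in>Q. forms_eval n F v \<noteq> (0, 0, 0) \<longrightarrow> \<phi> Q = hpoint (forms_eval n F v)"
      by (elim exE conjE)
    from ex obtain v where v: "v \<in> affine_point p" "forms_eval n F v \<noteq> (0, 0, 0)"
      by (elim bexE)
    obtain f1 f2 f3 where f: "F = (f1, f2, f3)"
      by (cases F)
    let ?f = "\<lambda>f q. form_eval n f (fst q, snd q, 1)"
    obtain c where c: "v = (c * fst p, c * snd p, c * 1)"
      using v(1) by (auto simp: affine_point_def hpoint_def)
    \<comment> \<open>By homogeneity, not vanishing at \<open>v\<close> passes to the representative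
      with last coordinate 1.\<close>
    have nz: "(?f f1 p, ?f f2 p, ?f f3 p) \<noteq> (0, 0, 0)"
      using v(2) unfolding forms_eval_def f c form_eval_scale by auto
    have val: "?f f3 q \<noteq> 0 \<and> ?f f1 q = ?f f3 q * fst (\<Phi> q) \<and> ?f f2 q = ?f f3 q * snd (\<Phi> q)"
      if q: "q \<in> affine C" "(?f f1 q, ?f f2 q, ?f f3 q) \<noteq> (0, 0, 0)" for q
    proof -
      have "hpoint (?f f1 q, ?f f2 q, ?f f3 q) = affine_point (\<Phi> q)"
        using F[rule_format, OF affine_point_in_points[OF q(1)], of "(fst q, snd q, 1)"]
          q(2) \<Phi>[OF q(1)] self_in_hpoint[of "(fst q, snd q, 1)"]
        by (simp add: affine_point_def forms_eval_def f)
      then show ?thesis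
        using hpoint_eq_affine_point by blast
    qed
    \<comment> \<open>Where all three forms vanish both sides are 0, so the identities hold on the
      whole affine curve and not only near \<open>p\<close>.\<close>
    have "?f f3 q * fst (\<Phi> q) = ?f f1 q \<and> ?f f3 q * snd (\<Phi> q) = ?f f2 q" if "q \<in> affine C" for q
      using val[OF that] by (cases "(?f f1 q, ?f f2 q, ?f f3 q) = (0, 0, 0)") auto
    then show ?thesis
      using val[OF p nz]
      by (intro exI[of _ "?f f3"] exI[of _ "?f f1"] exI[of _ "?f f2"] conjI ballI regular_form_eval) simp_all
  qed
  show "regular C (\<lambda>q. fst (\<Phi> q))"
  proof (rule regular_if_locally_regular)
    fix p assume "p \<in> affine C"
    from *[OF this] obtain h k l where h: "regular C h" "h p \<noteq> 0" and "regular C k" "regular C l"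
      and eq: "\<forall>q \<in> affine C. h q * fst (\<Phi> q) = k q \<and> h q * snd (\<Phi> q) = l q"
      by (elim exE conjE)
    have "regular C (\<lambda>q. h q * fst (\<Phi> q))"
      by (rule regular_cong[OF \<open>regular C k\<close>]) (simp add: eq)
    then show "\<exists>h. regular C h \<and> regular C (\<lambda>q. h q * fst (\<Phi> q)) \<and> h p \<noteq> 0"
      using h by (intro exI[of _ h] conjI)
  qed
  show "regular C (\<lambda>q. snd (\<Phi> q))"
  proof (rule regular_if_locally_regular)
    fix p assume "p \<in> affine C"
    from *[OF this] obtain h k l where h: "regular C h" "h p \<noteq> 0" and "regular C k" "regular C l"
      and eq: "\<forall>q \<in> affine C. h q * fst (\<Phi> q) = k q \<and> h q * snd (\<Phi> q) = l q"
      by (elim exE conjE)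
    have "regular C (\<lambda>q. h q * snd (\<Phi> q))"
      by (rule regular_cong[OF \<open>regular C l\<close>]) (simp add: eq)
    then show "\<exists>h. regular C h \<and> regular C (\<lambda>q. h q * snd (\<Phi> q)) \<and> h p \<noteq> 0"
      using h by (intro exI[of _ h] conjI)
  qed
qed

text \<open>The map \<open>\<phi>\<close> is injective on points and fixes the origin, so no affine
  point is sent to the origin.\<close>

lemma isomorphism_affine_part:
  assumes "curve_morphism C C' \<phi>" "\<forall>P\<in>points C. \<psi> (\<phi> P) = P" "\<phi> origin = origin"
  obtains \<Phi> where "\<And>q. q \<in> affine C \<Longrightarrow> \<Phi> q \<in> affine C'"
    "\<And>q. q \<in> affine C \<Longrightarrow> \<phi> (affine_point q) = affine_point (\<Phi> q)"
proof -
  have "\<exists>q'. q' \<in> affine C' \<and> \<phi> (affine_point q) = affine_point q'" if "q \<in> affine C" for q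
  proof -
    have q: "affine_point q \<in> points C"
      using that by (rule affine_point_in_points)
    have "\<phi> (affine_point q) \<noteq> origin"
      using assms(2,3) q origin_in_points affine_point_neq_origin by metis
    moreover have "\<phi> (affine_point q) \<in> points C'"
      using assms(1) q unfolding curve_morphism_def by blast
    ultimately show ?thesis
      using points_cases by metis
  qed
  then show thesis
    using that by metis
qed

text \<open>In the usual notation \<open>a\<close> is \<open>u^2\<close> and \<open>e\<close> is
  \<open>u^3\<close>; the relations compare coefficients of the two cubics under
  \<open>x -> a x + r\<close>, \<open>y -> e y\<close>.\<close>

theorem isomorphic_over_imp_substitution:
  fixes C C' :: "'a::field wcurve"
  assumes two: "(2::'a) \<noteq> 0" and iso: "isomorphic_over C C'"
  obtains a e r where "a \<noteq> 0" "e \<noteq> 0" "e ^ 2 = a ^ 3"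
    "e ^ 2 * coeff4 C = 3 * a * r ^ 2 + coeff4 C' * a"
    "e ^ 2 * coeff6 C = r ^ 3 + coeff4 C' * r + coeff6 C'"
proof -
  obtain \<phi> \<psi> where mor: "curve_morphism C C' \<phi>" "curve_morphism C' C \<psi>"
    and inv: "\<forall>P\<in>points C. \<psi> (\<phi> P) = P" "\<forall>Q\<in>points C'. \<phi> (\<psi> Q) = Q"
    and orig: "\<phi> origin = origin"
    using iso unfolding isomorphic_over_def by (elim exE conjE) (rule that)
  have orig': "\<psi> origin = origin"
    using inv(1) orig origin_in_points by metis
  obtain \<Phi> where \<Phi>: "\<And>q. q \<in> affine C \<Longrightarrow> \<Phi> q \<in> affine C'"
      "\<And>q. q \<in> affine C \<Longrightarrow> \<phi> (affine_point q) = affine_point (\<Phi> q)"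
    using isomorphism_affine_part[OF mor(1) inv(1) orig] by metis
  obtain \<Psi> where \<Psi>: "\<And>q. q \<in> affine C' \<Longrightarrow> \<Psi> q \<in> affine C"
      "\<And>q. q \<in> affine C' \<Longrightarrow> \<psi> (affine_point q) = affine_point (\<Psi> q)"
    using isomorphism_affine_part[OF mor(2) inv(2) orig'] by metis
  note reg = morphism_regular[OF mor(1) \<Phi>(2)] morphism_regular[OF mor(2) \<Psi>(2)]
  have "\<Psi> (\<Phi> q) = q" if "q \<in> affine C" for q
  proof (rule affine_point_inj)
    show "affine_point (\<Psi> (\<Phi> q)) = affine_point q"
      using \<Phi> \<Psi> inv(1) affine_point_in_points that by metis
  qed
  then have "has_order C (\<lambda>q. fst (\<Phi> q)) 2" "has_order C (\<lambda>q. snd (\<Phi> q)) 3"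
    using regular_iso_degree[OF two reg] \<Phi>(1) by simp_all
  then show thesis
    by (rule regular_iso_linear[OF two, of C _ _ C']) (use \<Phi>(1) that in simp_all)
qed

section \<open>Weierstrass substitutions in characteristic 3\<close>

lemma cube_add:
  fixes x y :: "'a::comm_ring_1"
  assumes "(3::'a) = 0"
  shows "(x + y) ^ 3 = x ^ 3 + y ^ 3"
proof -
  have "(x + y) ^ 3 = x ^ 3 + y ^ 3 + 3 * (x ^ 2 * y + x * y ^ 2)"
    by (simp add: power2_eq_square power3_eq_cube algebra_simps)
  then show ?thesis
    using assms by simp
qed

lemma three_eq_0_alg_closure: "(3::'a::field) = 0 \<Longrightarrow> (3::'a alg_closure) = 0"
  by (metis to_ac_0 to_ac_numeral)

lemma two_nonzero_char_3:
  assumes "(3::'a::comm_ring_1) = 0"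
  shows "(2::'a) \<noteq> 0"
proof
  assume "(2::'a) = 0"
  moreover have "(3::'a) = 2 + 1"
    by simp
  ultimately show False
    using assms by simp
qed

text \<open>The substitution \<open>(x, y) -> (u^2 x + r, u^3 y)\<close> in homogeneous
  coordinates.\<close>

definition weierstrass_map :: "'a::field \<Rightarrow> 'a \<Rightarrow> 'a alg_closure coords \<Rightarrow> 'a alg_closure coords" where
  "weierstrass_map u r v = (case v of (x, y, z) \<Rightarrow>
     (to_ac (u ^ 2) * x + to_ac r * z, to_ac (u ^ 3) * y, z))"

lemma weierstrass_map_forms: "\<exists>F. \<forall>v. forms_eval 1 F v = weierstrass_map u r v"
proof -
  \<comment> \<open>The coefficients of the linear form \<open>a X + b Y + c Z\<close>; index
    \<open>(0, 0)\<close> belongs to \<open>Z\<close>, whose exponent is what remains of the degree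
    1.\<close>
  define f where "f = (\<lambda>a b c i j. if (i, j) = (1::nat, 0::nat) then a else if (i, j) = (0, 1) then b
    else if (i, j) = (0, 0) then c else (0::'a))"
  have "form_eval 1 (f a b c) (x, y, z) = to_ac a * x + to_ac b * y + to_ac c * z"
    for a b c :: 'a and x y z
    by (simp add: form_eval_def f_def)
  then have "forms_eval 1 (f (u ^ 2) 0 r, f 0 (u ^ 3) 0, f 0 0 1) v = weierstrass_map u r v" for v
    by (cases v) (simp add: forms_eval_def weierstrass_map_def)
  then show ?thesis
    by blast
qed

text \<open>By linearity the map respects scaling, so the plain set image serves as the map on
  points.\<close>

lemma weierstrass_map_hpoint: "weierstrass_map u r ` hpoint v = hpoint (weierstrass_map u r v)"
proof (cases v)
  case (fields x y z)
  have "weierstrass_map u r (c * x, c * y, c * z) =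
      (c * (to_ac (u ^ 2) * x + to_ac r * z), c * (to_ac (u ^ 3) * y), c * z)" for c
    by (simp add: weierstrass_map_def algebra_simps)
  then show ?thesis
    by (simp add: fields hpoint_image image_image weierstrass_map_def[of u r "(x, y, z)"])
qed

lemma weierstrass_map_inverse:
  assumes "u \<noteq> 0"
  shows "weierstrass_map (inverse u) (- r * inverse u ^ 2) (weierstrass_map u r v) = v"
  using assms by (cases v) (simp add: weierstrass_map_def field_simps)

lemma weierstrass_map_nonzero: "u \<noteq> 0 \<Longrightarrow> v \<noteq> (0, 0, 0) \<Longrightarrow> weierstrass_map u r v \<noteq> (0, 0, 0)"
  by (cases v) (auto simp: weierstrass_map_def)

text \<open>Multiplying the equation of \<open>C\<close> by \<open>u^6\<close> gives that of
  \<open>C'\<close> in the new coordinates, because in characteristic 3 the cube of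
  \<open>u^2 x + r z\<close> has no mixed terms. One triple of linear forms works at every
  point.\<close>

lemma weierstrass_map_morphism:
  fixes C C' :: "'a::field wcurve"
  assumes "(3::'a) = 0" "u \<noteq> 0" "coeff4 C' = u ^ 4 * coeff4 C"
    "coeff6 C' + coeff4 C' * r + r ^ 3 = u ^ 6 * coeff6 C"
  shows "curve_morphism C C' ((`) (weierstrass_map u r))"
proof -
  let ?w = "weierstrass_map u r"
  have cub: "on_cubic C' (?w v)" if "on_cubic C v" for v
  proof (cases v)
    case (fields x y z)
    let ?U = "to_ac u" and ?R = "to_ac r" and ?A = "to_ac (coeff4 C)"
    have c6: "to_ac (coeff6 C') = ?U ^ 6 * to_ac (coeff6 C) - ?U ^ 4 * ?A * ?R - ?R ^ 3"
    proof -
      have "coeff6 C' = u ^ 6 * coeff6 C - u ^ 4 * coeff4 C * r - r ^ 3"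
        using assms(3,4) by (simp add: algebra_simps)
      then show ?thesis
        by simp
    qed
    have "(?U ^ 3 * y) ^ 2 * z = ?U ^ 6 * (y ^ 2 * z)"
      by (simp add: power_mult_distrib mult_ac flip: power_mult)
    also have "y ^ 2 * z = x ^ 3 + ?A * x * z ^ 2 + to_ac (coeff6 C) * z ^ 3"
      using that by (simp add: fields on_cubic_def)
    also have "?U ^ 6 * \<dots> = (?U ^ 2 * x) ^ 3 + (?R * z) ^ 3 +
        (?U ^ 4 * ?A) * (?U ^ 2 * x + ?R * z) * z ^ 2 + to_ac (coeff6 C') * z ^ 3"
      by (simp add: c6 power2_eq_square power3_eq_cube eval_nat_numeral algebra_simps)
    also have "(?U ^ 2 * x) ^ 3 + (?R * z) ^ 3 = (?U ^ 2 * x + ?R * z) ^ 3"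
      by (rule cube_add[symmetric]) (rule three_eq_0_alg_closure[OF assms(1)])
    finally show ?thesis
      by (simp add: fields on_cubic_def weierstrass_map_def assms(3))
  qed
  obtain F where F: "\<And>v. forms_eval 1 F v = ?w v"
    using weierstrass_map_forms[of u r] by blast
  show ?thesis
    unfolding curve_morphism_def
  proof (intro conjI ballI)
    fix P assume "P \<in> points C"
    then obtain v where v: "P = hpoint v" "v \<noteq> (0, 0, 0)" "on_cubic C v"
      unfolding points_def by blast
    have nz: "?w v \<noteq> (0, 0, 0)"
      using weierstrass_map_nonzero[OF assms(2) v(2)] .
    show "?w ` P \<in> points C'"
      unfolding points_def v(1) weierstrass_map_hpoint using nz cub[OF v(3)] by blast
    show "\<exists>n F. (\<exists>v\<in>P. forms_eval n F v \<noteq> (0, 0, 0)) \<and>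
        (\<forall>Q\<in>points C. \<forall>v\<in>Q. forms_eval n F v \<noteq> (0, 0, 0) \<longrightarrow>
          ?w ` Q = hpoint (forms_eval n F v))"
    proof (intro exI conjI ballI impI)
      show "\<exists>v\<in>P. forms_eval 1 F v \<noteq> (0, 0, 0)"
        using nz F v(1) self_in_hpoint by metis
      fix Q v assume "Q \<in> points C" "v \<in> Q"
      then have "Q = hpoint v"
        unfolding points_def using mem_hpoint_imp_eq by blast
      then show "?w ` Q = hpoint (forms_eval 1 F v)"
        unfolding F by (simp add: weierstrass_map_hpoint)
    qed
  qed
qed

lemma isomorphic_overI:
  fixes C C' :: "'a::field wcurve"
  assumes "(3::'a) = 0" "u \<noteq> 0" "coeff4 C' = u ^ 4 * coeff4 C"
    "coeff6 C' + coeff4 C' * r + r ^ 3 = u ^ 6 * coeff6 C"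
  shows "isomorphic_over C C'"
proof -
  \<comment> \<open>Parameters of the inverse substitution \<open>x -> (x - r) / u^2\<close>,
    \<open>y -> y / u^3\<close>.\<close>
  let ?u = "inverse u" and ?r = "- r * inverse u ^ 2"
  have "coeff6 C = (coeff6 C' + coeff4 C' * r + r ^ 3) / u ^ 6"
    using assms(2,4) by (simp add: field_simps)
  then have rev: "coeff4 C = ?u ^ 4 * coeff4 C'" "coeff6 C + coeff4 C * ?r + ?r ^ 3 = ?u ^ 6 * coeff6 C'"
    using assms(2,3) by (simp_all add: field_simps eval_nat_numeral)
  have inv: "weierstrass_map ?u ?r (weierstrass_map u r v) = v" for v
    using weierstrass_map_inverse[OF assms(2)] .
  have inv': "weierstrass_map u r (weierstrass_map ?u ?r v) = v" for v
    using weierstrass_map_inverse[of ?u ?r v] assms(2) by (simp add: field_simps)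
  show ?thesis
    unfolding isomorphic_over_def
  proof (intro exI conjI ballI)
    show "curve_morphism C C' ((`) (weierstrass_map u r))"
      using weierstrass_map_morphism assms by blast
    show "curve_morphism C' C ((`) (weierstrass_map ?u ?r))"
      using weierstrass_map_morphism[OF assms(1) _ rev] assms(2) by simp
    \<comment> \<open>The zeros are written as multiples of \<open>u^3\<close> so that
      \<open>hpoint_scale\<close> applies.\<close>
    have "weierstrass_map u r (0, 1, 0) = (to_ac (u ^ 3) * 0, to_ac (u ^ 3) * 1, to_ac (u ^ 3) * 0)"
      by (simp add: weierstrass_map_def)
    then show "weierstrass_map u r ` origin = origin"
      unfolding origin_def weierstrass_map_hpoint using hpoint_scale assms(2)
      by (metis power_not_zero to_ac_eq_0_iff)
  qed (use inv inv' in \<open>simp_all add: image_image\<close>)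
qed

theorem isomorphic_over_iff_char_3:
  fixes C C' :: "'a::field wcurve"
  assumes "(3::'a) = 0"
  shows "isomorphic_over C C' \<longleftrightarrow> (\<exists>u r. u \<noteq> 0 \<and> coeff4 C' = u ^ 4 * coeff4 C \<and>
    coeff6 C' + coeff4 C' * r + r ^ 3 = u ^ 6 * coeff6 C)"
proof
  assume "isomorphic_over C C'"
  then obtain a e r where *: "a \<noteq> 0" "e \<noteq> 0" "e ^ 2 = a ^ 3"
      "e ^ 2 * coeff4 C = 3 * a * r ^ 2 + coeff4 C' * a"
      "e ^ 2 * coeff6 C = r ^ 3 + coeff4 C' * r + coeff6 C'"
    using isomorphic_over_imp_substitution[OF two_nonzero_char_3[OF assms]] by metis
  \<comment> \<open>From \<open>e^2 = a^3\<close> this quotient satisfies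
    \<open>u^2 = a\<close>.\<close>
  define u where "u = e / a"
  have u2: "u ^ 2 = a"
    using * by (simp add: u_def power_divide power2_eq_square power3_eq_cube)
  have "u ^ 4 = (u ^ 2) ^ 2" "u ^ 6 = (u ^ 2) ^ 3"
    by (simp_all flip: power_mult)
  then have u46: "u ^ 4 = a ^ 2" "u ^ 6 = a ^ 3"
    using u2 by simp_all
  \<comment> \<open>The term \<open>3 * a * r ^ 2\<close> vanishes in characteristic 3, so the shift
    \<open>r\<close> leaves no trace in the linear coefficient.\<close>
  have "a * (a ^ 2 * coeff4 C) = a * coeff4 C'"
    using *(3,4) assms by (simp add: power2_eq_square power3_eq_cube mult_ac)
  then have "coeff4 C' = u ^ 4 * coeff4 C"
    using *(1) u46 by simp
  moreover have "coeff6 C' + coeff4 C' * r + r ^ 3 = u ^ 6 * coeff6 C"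
    using *(3,5) u46 by (simp add: algebra_simps)
  moreover have "u \<noteq> 0"
    using * by (simp add: u_def)
  ultimately show "\<exists>u r. u \<noteq> 0 \<and> coeff4 C' = u ^ 4 * coeff4 C \<and>
      coeff6 C' + coeff4 C' * r + r ^ 3 = u ^ 6 * coeff6 C"
    by blast
qed (use isomorphic_overI[OF assms] in blast)

section \<open>Trace and classification\<close>

text \<open>Multiplication by a nonzero \<open>x\<close> permutes the nonzero elements; comparing
  their products gives \<open>x^(q-1) = 1\<close>.\<close>

lemma finite_field_power_CARD:
  fixes x :: "'a::{field, finite}"
  shows "x ^ CARD('a) = x"
proof (cases "x = 0")
  case True
  then show ?thesis
    by simp
next
  case False
  let ?S = "UNIV - {0::'a}"
  have "bij_betw ((*) x) ?S ?S"
    by (rule bij_betwI[where g = "\<lambda>y. y / x"]) (use False in auto)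
  then have "\<Prod>?S = (\<Prod>y\<in>?S. x * y)"
    by (rule prod.reindex_bij_betw[symmetric])
  also have "\<dots> = x ^ (CARD('a) - 1) * \<Prod>?S"
    by (simp add: prod.distrib card_Diff_singleton)
  finally have "x ^ (CARD('a) - 1) = 1"
    by simp
  moreover have "CARD('a) = Suc (CARD('a) - 1)"
    by simp
  ultimately show ?thesis
    by (metis power_Suc mult.right_neutral)
qed

text \<open>Translation by 1 permutes the field; comparing the sums of all elements gives
  \<open>3^d = 0\<close> in it.\<close>

lemma three_eq_0_if_CARD:
  assumes "CARD('a::{field, finite}) = 3 ^ d"
  shows "(3::'a) = 0"
proof -
  have "(\<Sum>y\<in>UNIV. y) = (\<Sum>y\<in>UNIV. y + (1::'a))"
    by (rule sum.reindex_bij_betw[symmetric], rule bij_betwI[where g = "\<lambda>y. y - 1"]) auto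
  also have "\<dots> = (\<Sum>y\<in>UNIV. y) + of_nat CARD('a)"
    by (simp add: sum.distrib)
  finally have "(3::'a) ^ d = 0"
    using assms by simp
  then show ?thesis
    by simp
qed

context
  assumes char3: "(3::'a::field) = 0"
begin

lemma cube_sum: "(\<Sum>i\<in>I. f i) ^ 3 = (\<Sum>i\<in>I. f i ^ (3::nat))" for f :: "'b \<Rightarrow> 'a"
  by (induction I rule: infinite_finite_induct) (simp_all add: cube_add[OF char3])

lemma power_3_power_add: "(x + y) ^ 3 ^ i = x ^ 3 ^ i + y ^ 3 ^ i" for x y :: 'a
  by (induction i) (simp_all add: cube_add[OF char3] power_mult mult.commute[of 3])

lemma Tr_add: "Tr d (x + y) = Tr d x + Tr d y" for x y :: 'a
  by (simp add: Tr_def power_3_power_add sum.distrib)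

lemma Tr_minus: "Tr d (- x) = - Tr d x" for x :: 'a
  by (simp add: Tr_def power_minus_odd sum_negf)

lemma Tr_diff: "Tr d (x - y) = Tr d x - Tr d y" for x y :: 'a
  using Tr_add[of d x "- y"] by (simp add: Tr_minus)

lemma Tr_cube: "Tr d x ^ 3 = (\<Sum>i<d. x ^ 3 ^ Suc i)" for x :: 'a
  by (simp add: Tr_def cube_sum mult.commute flip: power_mult)

text \<open>Cubing moves each conjugate to the next. The length \<open>d\<close> is arbitrary here,
  since the solution for Hilbert 90 uses partial traces.\<close>

lemma Tr_cube_Suc: "Tr d x ^ 3 = Tr (Suc d) x - x" for x :: 'a
  unfolding Tr_cube Tr_def[of "Suc d"] sum.lessThan_Suc_shift by simp

end

context
  fixes d :: nat
  assumes CARD: "CARD('a::{field, finite}) = 3 ^ d"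
begin

lemma char3: "(3::'a) = 0"
  using CARD by (rule three_eq_0_if_CARD)

text \<open>The conjugate with exponent \<open>3^d\<close> is \<open>x\<close> again.\<close>

lemma Tr_Suc: "Tr (Suc d) x = Tr d x + x" for x :: 'a
  using finite_field_power_CARD[of x] by (simp add: Tr_def CARD)

text \<open>The trace commutes with cubing and is itself fixed by it.\<close>

lemma Tr_artin_schreier: "Tr d (x ^ 3 - x) = 0" for x :: 'a
proof -
  have "Tr d (x ^ 3) = Tr d x ^ 3"
    by (simp add: Tr_cube[OF char3]) (simp add: Tr_def flip: power_mult)
  then show ?thesis
    by (simp add: Tr_diff[OF char3] Tr_cube_Suc[OF char3] Tr_Suc)
qed

text \<open>The trace is a root of \<open>T^3 - T = T (T - 1) (T + 1)\<close>.\<close>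

lemma Tr_cases:
  fixes x :: 'a
  obtains "Tr d x = 0" | "Tr d x = 1" | "Tr d x = - 1"
proof -
  have "Tr d x ^ 3 = Tr d x"
    by (simp add: Tr_cube_Suc[OF char3] Tr_Suc)
  then have "Tr d x * ((Tr d x - 1) * (Tr d x + 1)) = 0"
    by (simp add: power3_eq_cube algebra_simps)
  then show thesis
    using that by (auto simp: eq_neg_iff_add_eq_0)
qed

text \<open>Additive Hilbert 90, with the classical explicit solution.\<close>

lemma Tr_eq_0_imp_artin_schreier:
  fixes \<alpha> b :: 'a
  assumes "Tr d \<alpha> = 1" "Tr d b = 0"
  obtains r where "r ^ 3 - r = b"
proof -
  \<comment> \<open>The sum of the \<open>t i\<close> for \<open>i < d\<close> is the solution. Its
    summands carry partial traces of \<open>\<alpha>\<close>, so cubing turns \<open>t i\<close>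
    into \<open>t (Suc i)\<close> up to a multiple of \<open>\<alpha>\<close>.\<close>
  define t where "t i = Tr i \<alpha> * b ^ 3 ^ i" for i
  have "(t i) ^ 3 = t (Suc i) - \<alpha> * b ^ 3 ^ Suc i" for i
    by (simp add: t_def power_mult_distrib Tr_cube_Suc[OF char3] algebra_simps flip: power_mult)
  then have "(\<Sum>i<d. t i) ^ 3 - (\<Sum>i<d. t i) =
      (\<Sum>i<d. t (Suc i) - t i) - \<alpha> * (\<Sum>i<d. b ^ 3 ^ Suc i)"
    by (simp add: cube_sum[OF char3] sum_subtractf sum_distrib_left)
  also have "\<dots> = t d - t 0 - \<alpha> * Tr d b ^ 3"
    by (simp only: sum_lessThan_telescope Tr_cube[OF char3])
  \<comment> \<open>Here \<open>t 0 = 0\<close> as an empty trace, and \<open>t d = b\<close> since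
    \<open>Tr d \<alpha> = 1\<close> and \<open>b^(3^d) = b\<close>.\<close>
  also have "\<dots> = b"
    using assms finite_field_power_CARD[of b] by (simp add: t_def CARD) (simp add: Tr_def)
  finally show thesis
    using that by blast
qed

lemma power2_of_power4_eq_1: "u ^ 4 = (1::'a) \<Longrightarrow> u ^ 2 = 1 \<or> u ^ 2 = - 1"
  using power2_eq_1_iff[of "u ^ 2"] by (simp flip: power_mult)

text \<open>Preserving the linear coefficient \<open>-1\<close> means \<open>u^4 = 1\<close>;
  additive Hilbert 90 then turns the existence of \<open>r\<close> into the vanishing of a
  trace.\<close>

lemma curve_E_isomorphic_iff:
  fixes \<alpha> b b' :: 'a
  assumes \<alpha>: "Tr d \<alpha> = 1"
  shows "isomorphic_over (curve_E b) (curve_E b') \<longleftrightarrow> (\<exists>u. u ^ 4 = 1 \<and> Tr d b' = u ^ 2 * Tr d b)"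
proof -
  \<comment> \<open>As \<open>u^6 = u^2\<close> is 1 or -1, it can be taken out of the
    trace.\<close>
  have Tr_u: "Tr d (u ^ 6 * b) = u ^ 2 * Tr d b" if "u ^ 4 = 1" for u
  proof -
    have "u ^ 6 = u ^ 4 * u ^ 2"
      by (simp flip: power_add)
    then show ?thesis
      using power2_of_power4_eq_1[OF that] that Tr_minus[OF char3, of d b] by auto
  qed
  have "isomorphic_over (curve_E b) (curve_E b') \<longleftrightarrow>
      (\<exists>u r. u ^ 4 = 1 \<and> r ^ 3 - r = u ^ 6 * b - b')"
    unfolding isomorphic_over_iff_char_3[OF char3]
  proof (intro ex_cong1)
    fix u r :: 'a
    have "u \<noteq> 0" if "u ^ 4 = 1"
      using that by auto
    then show "(u \<noteq> 0 \<and> coeff4 (curve_E b') = u ^ 4 * coeff4 (curve_E b) \<and>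
        coeff6 (curve_E b') + coeff4 (curve_E b') * r + r ^ 3 = u ^ 6 * coeff6 (curve_E b)) \<longleftrightarrow>
      (u ^ 4 = 1 \<and> r ^ 3 - r = u ^ 6 * b - b')"
      by (auto simp: curve_E_def algebra_simps)
  qed
  also have "\<dots> \<longleftrightarrow> (\<exists>u. u ^ 4 = 1 \<and> Tr d (u ^ 6 * b - b') = 0)"
    using Tr_artin_schreier Tr_eq_0_imp_artin_schreier[OF \<alpha>] by metis
  also have "\<dots> \<longleftrightarrow> (\<exists>u. u ^ 4 = 1 \<and> Tr d b' = u ^ 2 * Tr d b)"
    by (intro ex_cong1 conj_cong refl) (auto simp: Tr_diff[OF char3] Tr_u)
  finally show ?thesis .
qed

text \<open>Here \<open>q = 4 m + 3\<close>, so a square root \<open>z\<close> of -1 would satisfy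
  \<open>z = z^q = - z\<close>.\<close>

lemma minus_1_nonsquare_if_odd:
  assumes "odd d"
  shows "\<nexists>z::'a. z ^ 2 = - 1"
proof
  assume "\<exists>z::'a. z ^ 2 = - 1"
  then obtain z :: 'a where z: "z ^ 2 = - 1" ..
  obtain k where k: "d = 2 * k + 1"
    using assms by (elim oddE)
  have "(3::nat) ^ d mod 4 = 3"
  proof -
    have "(9::nat) ^ k mod 4 = 1"
      by (induction k) (simp_all add: mod_mult_right_eq[symmetric, of 9])
    then show ?thesis
      by (simp add: k power_mult mod_mult_right_eq[symmetric, of 3])
  qed
  then obtain m where "(3::nat) ^ d = 4 * m + 3"
    by (metis mult_div_mod_eq)
  then have "z = (z ^ 2) ^ (2 * m) * z ^ 2 * z"
    using finite_field_power_CARD[of z] CARD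
    by (simp add: power_add mult.assoc flip: power_mult power_Suc2)
  then have "2 * z = 0"
    using z by simp
  then show False
    using z two_nonzero_char_3[OF char3] by auto
qed

text \<open>Here \<open>q = 4 m + 1\<close>. Some \<open>g\<close> has \<open>g^(2 m) = - 1\<close>,
  and then \<open>g^m\<close> is a square root of -1.\<close>

lemma minus_1_square_if_even:
  assumes "d \<ge> 1" "even d"
  obtains z :: 'a where "z ^ 2 = - 1"
proof -
  obtain k where k: "d = 2 * k" "k > 0"
    using assms by (auto elim!: evenE)
  have "(9::nat) ^ k mod 4 = 1"
    by (induction k) (simp_all add: mod_mult_right_eq[symmetric, of 9])
  then obtain m where "(9::nat) ^ k = 4 * m + 1"
    by (metis mult_div_mod_eq)
  then have m: "CARD('a) = 4 * m + 1"
    using CARD k by (simp add: power_mult)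
  have "m > 0"
    using m CARD k by (cases m) auto
  \<comment> \<open>The polynomial \<open>X^(2m+1) - X\<close> has degree less than
    \<open>q\<close>, so some \<open>g\<close> is not a root. Then \<open>g^(2m)\<close> is not 1,
    though its square is.\<close>
  let ?p = "Polynomial.monom (1::'a) (2 * m + 1) - Polynomial.monom 1 1"
  have "Polynomial.degree ?p = 2 * m + 1"
    using \<open>m > 0\<close> degree_add_eq_left[of "- Polynomial.monom (1::'a) 1" "Polynomial.monom (1::'a) (2 * m + 1)"]
    by (simp add: Polynomial.degree_monom_eq)
  then have "card {x. poly ?p x = 0} \<le> 2 * m + 1"
    using card_poly_roots_bound[of ?p] by fastforce
  then have "{x. poly ?p x = 0} \<noteq> UNIV"
    using m \<open>m > 0\<close> by auto
  then obtain g where "poly ?p g \<noteq> 0"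
    by blast
  then have g: "g * g ^ (2 * m) \<noteq> g"
    by (simp add: poly_monom)
  have "g * (g ^ (2 * m)) ^ 2 = g"
    using finite_field_power_CARD[of g] m by (simp add: mult.commute flip: power_mult power_Suc)
  then have "(g ^ (2 * m)) ^ 2 = 1"
    using g by auto
  then have "g ^ (2 * m) = - 1"
    using g power2_eq_1_iff by fastforce
  then show thesis
    using that[of "g ^ m"] by (simp add: mult.commute flip: power_mult)
qed

text \<open>In characteristic 3 the first partial derivative is \<open>z^2\<close>. At a common zero
  \<open>z = 0\<close>, then the third gives \<open>y = 0\<close>, and the equation gives
  \<open>x = 0\<close>.\<close>

lemma elliptic_curve_E: "elliptic_curve (curve_E (b::'a))"
proof -
  have "(3::'a alg_closure) = 0" "(2::'a alg_closure) \<noteq> 0"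
    using three_eq_0_alg_closure[OF char3] two_nonzero_char_3 by blast+
  then show ?thesis
    unfolding elliptic_curve_def curve_E_def on_cubic_def by auto
qed

end

section \<open>Counting isomorphism classes\<close>

lemma card_isomorphism_classes:
  assumes "\<And>C C'. C \<in> S \<Longrightarrow> C' \<in> S \<Longrightarrow> isomorphic_over C C' \<longleftrightarrow> f C = f C'"
  shows "card (isomorphism_classes S) = card (f ` S)"
proof -
  have "{(C, C'). C \<in> S \<and> C' \<in> S \<and> isomorphic_over C C'} `` {C} = {C' \<in> S. f C' = f C}"
    if "C \<in> S" for C
    using assms[OF that] that by auto
  \<comment> \<open>A complete invariant has the isomorphism classes as its fibres.\<close>
  then have "isomorphism_classes S = (\<lambda>t. {C \<in> S. f C = t}) ` f ` S"
    unfolding isomorphism_classes_def quotient_def by auto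
  moreover have "inj_on (\<lambda>t. {C \<in> S. f C = t}) (f ` S)"
    by (rule inj_onI) blast
  ultimately show ?thesis
    by (simp add: card_image)
qed

lemma card_isomorphism_classes_curve_E:
  fixes f :: "'a::field \<Rightarrow> 'b"
  assumes "\<And>b b'. isomorphic_over (curve_E b) (curve_E b') \<longleftrightarrow> f b = f b'"
  shows "card (isomorphism_classes (range (curve_E :: 'a \<Rightarrow> 'a wcurve))) = card (range f)"
proof -
  let ?S = "range (curve_E :: 'a \<Rightarrow> 'a wcurve)"
  have coeff6: "coeff6 (curve_E b) = b" for b :: 'a
    by (simp add: curve_E_def)
  have "card (isomorphism_classes ?S) = card ((\<lambda>C. f (coeff6 C)) ` ?S)"
    by (rule card_isomorphism_classes) (use assms in \<open>auto simp: coeff6\<close>)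
  then show ?thesis
    by (simp add: image_image coeff6)
qed

theorem mainTheorem1:
  fixes \<alpha> :: "'a :: {field, finite}" and d :: nat
  assumes "d \<ge> 1" and "CARD('a) = 3 ^ d" and "Tr d \<alpha> = 1"
  shows "(\<forall>(E :: 'a wcurve) v.
            elliptic_curve E \<longrightarrow> v \<noteq> 0 \<longrightarrow> - coeff4 E = v ^ 4 \<longrightarrow>
              isomorphic_over E (curve_E (coeff6 E * inverse v ^ 6)) \<and>
              (\<forall>E'. elliptic_curve E' \<longrightarrow> isomorphic_over E' E \<longrightarrow> type_I E')) \<and>
         (\<forall>b :: 'a. elliptic_curve (curve_E b)) \<and>
         (odd d \<longrightarrow>
            card (isomorphism_classes (range (curve_E :: 'a \<Rightarrow> 'a wcurve))) = 3 \<and>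
            (\<forall>b b' :: 'a. isomorphic_over (curve_E b) (curve_E b') \<longleftrightarrow> Tr d b = Tr d b') \<and>
            (\<nexists>z :: 'a. z ^ 2 = - 1) \<and>
            (\<forall>b :: 'a.
               (Tr d b = 0 \<longrightarrow> isomorphic_over (curve_E b) (curve_E 0)) \<and>
               (Tr d b = 1 \<longrightarrow> isomorphic_over (curve_E b) (curve_E \<alpha>)) \<and>
               (Tr d b = - 1 \<longrightarrow>
                  isomorphic_over (curve_E b) (quadratic_twist (- 1) (curve_E \<alpha>))))) \<and>
         (even d \<longrightarrow>
            card (isomorphism_classes (range (curve_E :: 'a \<Rightarrow> 'a wcurve))) = 2 \<and>
            (\<forall>b :: 'a.
               (Tr d b = 0 \<longrightarrow> isomorphic_over (curve_E b) (curve_E 0)) \<and>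
               (Tr d b \<noteq> 0 \<longrightarrow> isomorphic_over (curve_E b) (curve_E \<alpha>))))"
proof (intro conjI impI allI)
  note CARD = assms(2) and \<alpha> = assms(3)
  note char3 = char3[OF CARD]
  have two: "(2::'a) \<noteq> 0"
    using two_nonzero_char_3[OF char3] .
  then have one: "(1::'a) \<noteq> - 1"
    by (metis add.right_inverse one_add_one)
  have power4: "x ^ 4 = (x ^ 2) ^ 2" for x :: 'a
    by (simp flip: power_mult)
  have Tr_0: "Tr d (0::'a) = 0"
    using Tr_diff[OF char3, of d 0 0] by simp
  have Tr_neg: "Tr d (- \<alpha>) = - 1"
    using Tr_minus[OF char3] \<alpha> by metis
  note iso_iff = curve_E_isomorphic_iff[OF CARD \<alpha>]
  {
    fix E :: "'a wcurve" and v
    assume v: "v \<noteq> 0" "- coeff4 E = v ^ 4"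
    \<comment> \<open>Scaling by \<open>u = 1/v\<close> without a shift turns the linear coefficient
      \<open>- v^4\<close> into \<open>-1\<close>.\<close>
    show "isomorphic_over E (curve_E (coeff6 E * inverse v ^ 6))"
    proof (rule isomorphic_overI[OF char3, of "inverse v" _ _ 0])
      have "coeff4 E = - (v ^ 4)"
        using v(2) by (metis minus_minus)
      then show "coeff4 (curve_E (coeff6 E * inverse v ^ 6)) = inverse v ^ 4 * coeff4 E"
        using v(1) by (simp add: curve_E_def field_simps)
    qed (use v in \<open>simp_all add: curve_E_def\<close>)
    fix E' :: "'a wcurve"
    assume "isomorphic_over E' E"
    then obtain u where u: "u \<noteq> 0" "coeff4 E = u ^ 4 * coeff4 E'"
      unfolding isomorphic_over_iff_char_3[OF char3] by blast
    have "- coeff4 E' = (v / u) ^ 4"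
      using u v(2) by (simp add: power_divide field_simps flip: v(2))
    then show "type_I E'"
      unfolding type_I_def using u(1) v(1) by (metis divide_eq_0_iff)
  }
  show "elliptic_curve (curve_E b)" for b :: 'a
    using elliptic_curve_E[OF CARD] .
  {
    assume "odd d"
    show nonsquare: "\<nexists>z::'a. z ^ 2 = - 1"
      using minus_1_nonsquare_if_odd[OF CARD \<open>odd d\<close>] .
    show iso: "isomorphic_over (curve_E b) (curve_E b') \<longleftrightarrow> Tr d b = Tr d b'" for b b' :: 'a
    proof -
      have u2: "u ^ 2 = 1" if "u ^ 4 = 1" for u :: 'a
        using nonsquare power2_of_power4_eq_1[OF CARD that] by blast
      show ?thesis
        unfolding iso_iff
      proof
        assume "\<exists>u. u ^ 4 = 1 \<and> Tr d b' = u ^ 2 * Tr d b"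
        then obtain u where "u ^ 4 = 1" "Tr d b' = u ^ 2 * Tr d b"
          by blast
        then show "Tr d b = Tr d b'"
          by (simp add: u2)
      next
        assume "Tr d b = Tr d b'"
        then show "\<exists>u. u ^ 4 = 1 \<and> Tr d b' = u ^ 2 * Tr d b"
          by (intro exI[of _ 1]) simp
      qed
    qed
    have "range (Tr d) = {0, 1, - 1 :: 'a}"
    proof
      have "Tr d x \<in> {0, 1, - 1}" for x :: 'a
        by (rule Tr_cases[OF CARD, of x]) simp_all
      then show "range (Tr d) \<subseteq> {0, 1, - 1 :: 'a}"
        by (rule image_subsetI)
      show "{0, 1, - 1} \<subseteq> range (Tr d :: 'a \<Rightarrow> 'a)"
        using rangeI[of "Tr d" "0::'a"] rangeI[of "Tr d" \<alpha>] rangeI[of "Tr d" "- \<alpha>"]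
        by (simp add: Tr_0 \<alpha> Tr_neg)
    qed
    moreover have "card {0, 1, - 1 :: 'a} = 3"
      using one by simp
    ultimately show "card (isomorphism_classes (range (curve_E :: 'a \<Rightarrow> 'a wcurve))) = 3"
      using card_isomorphism_classes_curve_E[OF iso] by simp
    fix b :: 'a
    \<comment> \<open>The square of -1 keeps the linear coefficient and its cube negates the
      constant one; \<open>- \<alpha>\<close> has trace -1.\<close>
    have "quadratic_twist (- 1) (curve_E \<alpha>) = curve_E (- \<alpha>)"
      by (simp add: quadratic_twist_def curve_E_def)
    then show "Tr d b = 0 \<Longrightarrow> isomorphic_over (curve_E b) (curve_E 0)"
      "Tr d b = 1 \<Longrightarrow> isomorphic_over (curve_E b) (curve_E \<alpha>)"
      "Tr d b = - 1 \<Longrightarrow> isomorphic_over (curve_E b) (quadratic_twist (- 1) (curve_E \<alpha>))"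
      using iso Tr_0 \<alpha> Tr_neg by simp_all
  }
  {
    assume "even d"
    then obtain i :: 'a where i: "i ^ 2 = - 1"
      using minus_1_square_if_even[OF CARD assms(1)] by blast
    then have "i ^ 4 = 1"
      using power4[of i] by simp
    \<comment> \<open>Now \<open>u^2\<close> takes both values 1 and -1, so the trace matters only
      up to sign, which its square records.\<close>
    have iso: "isomorphic_over (curve_E b) (curve_E b') \<longleftrightarrow> Tr d b ^ 2 = Tr d b' ^ 2" for b b' :: 'a
    proof -
      have "isomorphic_over (curve_E b) (curve_E b') \<longleftrightarrow> Tr d b' = Tr d b \<or> Tr d b' = - Tr d b"
        unfolding iso_iff
      proof
        assume "\<exists>u. u ^ 4 = 1 \<and> Tr d b' = u ^ 2 * Tr d b"
        then show "Tr d b' = Tr d b \<or> Tr d b' = - Tr d b"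
          using power2_of_power4_eq_1[OF CARD] by (elim exE conjE) (metis mult_1 mult_minus1)
      next
        assume "Tr d b' = Tr d b \<or> Tr d b' = - Tr d b"
        then show "\<exists>u. u ^ 4 = 1 \<and> Tr d b' = u ^ 2 * Tr d b"
        proof
          assume "Tr d b' = Tr d b"
          then show ?thesis
            by (intro exI[of _ 1]) simp
        next
          assume "Tr d b' = - Tr d b"
          then show ?thesis
            using i \<open>i ^ 4 = 1\<close> by (intro exI[of _ i]) simp
        qed
      qed
      then show ?thesis
        by (auto simp: power2_eq_iff)
    qed
    have Tr_sq: "Tr d b ^ 2 = (if Tr d b = 0 then 0 else 1)" for b :: 'a
      by (rule Tr_cases[OF CARD, of b]) simp_all
    have "range (\<lambda>b::'a. Tr d b ^ 2) = {0, 1}"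
    proof
      show "{0, 1} \<subseteq> range (\<lambda>b::'a. Tr d b ^ 2)"
        using rangeI[of "\<lambda>b::'a. Tr d b ^ 2" 0] rangeI[of "\<lambda>b::'a. Tr d b ^ 2" \<alpha>] \<alpha> Tr_0 by simp
    qed (auto simp: Tr_sq)
    then show "card (isomorphism_classes (range (curve_E :: 'a \<Rightarrow> 'a wcurve))) = 2"
      using card_isomorphism_classes_curve_E[of "\<lambda>b::'a. Tr d b ^ 2", OF iso] by simp
    fix b :: 'a
    show "Tr d b = 0 \<Longrightarrow> isomorphic_over (curve_E b) (curve_E 0)"
      "Tr d b \<noteq> 0 \<Longrightarrow> isomorphic_over (curve_E b) (curve_E \<alpha>)"
      using iso Tr_0 \<alpha> Tr_sq by simp_all
  }
qed

end
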